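(* Let $\alpha>0$, let $\nu\in\mathcal{P}_+$ with $\nu\ne\delta_0$, and let $R(t)=\mathbf{E}N(t)$ be the renewal function of the renewal process for the Kendall convolution $\vartriangle_\alpha$ with unit step distribution $\nu$. If $H(\infty)=m(\alpha)<\infty$, then $H\in RV_0$ and, as $x\to\infty$, $$x^\alpha\overline{F}(x)\to0,\qquad x^\alpha\overline{G}(x)\to m(\alpha),\qquad x^{-\alpha}R(x)\to\frac{2}{m(\alpha)}.$$
   Context: $\mathcal{P}_+$ is the set of Borel probability measures on $[0,\infty)$. For $\alpha>0$ the Kendall convolution $\vartriangle_\alpha$ is the commutative, associative operation on $\mathcal{P}_+$ given by $\delta_x\vartriangle_\alpha\delta_1=(1-x^\alpha)\delta_1+x^\alpha\pi_{2\alpha}$ for $x\in[0,1]$, where $\pi_{2\alpha}(dy)=2\alpha y^{-2\alpha-1}\mathbf{1}_{[1,\infty)}(y)\,dy$; by scaling, for $0\le x\le y$, $y>0$, $\delta_x\vartriangle_\alpha\delta_y$ is the law of $yX$ where $X$ has law $\delta_{x/y}\vartriangle_\alpha\delta_1$; $\delta_0\vartriangle_\alpha\delta_0=\delta_0$; and $(\lambda_1\vartriangle_\alpha\lambda_2)(A)=\int\int(\delta_x\vartriangle_\alpha\delta_y)(A)\,\lambda_1(dx)\lambda_2(dy)$. $\nu^{\vartriangle_\alpha n}$ is the $n$-fold convolution power. The Kendall random walk with step distribution $\nu$ is the Markov process $(S_n)_{n\ge1}$ with $\mathcal{L}(S_1)=\nu$ and $P(S_n\in\cdot\mid S_k=x)=\delta_x\vartriangle_\alpha\nu^{\vartriangle_\alpha(n-k)}$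 for $k<n$. The renewal process is $N(t)=\inf\{n\ge0:S_{n+1}>t\}$ ($=\infty$ if no such $n$ exists). $\overline F(t)=\nu((t,\infty))$; for $t>0$, $G(t)=\int_{[0,\infty)}(1-x^\alpha/t^\alpha)_+\,\nu(dx)$ with $a_+=\max\{a,0\}$, $\overline G=1-G$; $H(t)=\int_{[0,t]}x^\alpha\,\nu(dx)$; $m(\alpha)=\int_{[0,\infty)}x^\alpha\,\nu(dx)=\lim_{t\to\infty}H(t)$. A measurable function $f$, positive for all sufficiently large arguments, is in $RV_0$ if $\lim_{t\to\infty}f(tx)/f(t)=1$ for all $x>0$. *)

theory Defs
  imports "HOL-Probability.Probability"
begin

abbreviation borel_nonneg :: "real measure" where
  "borel_nonneg \<equiv> restrict_space borel {0..}"

abbreviation P_plus :: "real measure set" where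
  "P_plus \<equiv> space (prob_algebra borel_nonneg)"

section \<open>Kendall convolution\<close>

definition pareto :: "real \<Rightarrow> real measure" where
  "pareto \<beta> = restrict_space
     (density lborel (\<lambda>y. ennreal (\<beta> * y powr (- \<beta> - 1) * indicator {1..} y))) {0..}"

text \<open>The convolution of the point masses at \<open>x\<close> and \<open>1\<close>, for \<open>0 \<le> x \<le> 1\<close>.
  The library fixes \<open>0 powr \<alpha> = 0\<close>, as needed at \<open>x = 0\<close>.\<close>

definition kendall_unit :: "real \<Rightarrow> real \<Rightarrow> real measure" where
  "kendall_unit \<alpha> x = measure_of {0..} (sets borel_nonneg)
     (\<lambda>A. ennreal (1 - x powr \<alpha>) * emeasure (return borel_nonneg 1) A
        + ennreal (x powr \<alpha>) * emeasure (pareto (2 * \<alpha>)) A)"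

definition kendall_dirac :: "real \<Rightarrow> real \<Rightarrow> real \<Rightarrow> real measure" where
  "kendall_dirac \<alpha> x y =
     (if max x y = 0 then return borel_nonneg 0
      else distr (kendall_unit \<alpha> (min x y / max x y)) borel_nonneg (\<lambda>z. max x y * z))"

text \<open>The monadic bind is the mixture: its value at \<open>A\<close> is the double integral of
  \<open>emeasure (kendall_dirac \<alpha> x y) A\<close>.\<close>

definition kendall_conv :: "real \<Rightarrow> real measure \<Rightarrow> real measure \<Rightarrow> real measure" where
  "kendall_conv \<alpha> \<mu>\<^sub>1 \<mu>\<^sub>2 = \<mu>\<^sub>1 \<bind> (\<lambda>x. \<mu>\<^sub>2 \<bind> (\<lambda>y. kendall_dirac \<alpha> x y))"

text \<open>The point mass at 0 is the neutral element, hence the zeroth power.\<close>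

primrec kendall_power :: "real \<Rightarrow> real measure \<Rightarrow> nat \<Rightarrow> real measure" where
  "kendall_power \<alpha> \<nu> 0 = return borel_nonneg 0"
| "kendall_power \<alpha> \<nu> (Suc n) = kendall_conv \<alpha> \<nu> (kendall_power \<alpha> \<nu> n)"

section \<open>Kendall random walk and renewal function\<close>

definition history :: "'a measure \<Rightarrow> (nat \<Rightarrow> 'a \<Rightarrow> real) \<Rightarrow> nat \<Rightarrow> 'a measure" where
  "history M S k =
     sigma (space M) (\<Union>i\<in>{1..k}. {S i -` A \<inter> space M | A. A \<in> sets borel_nonneg})"

text \<open>The walk is indexed from 1; \<open>S 0\<close> is irrelevant. The last condition is the Markov
  property together with the prescribed transition probabilities: conditioning on the whole
  history up to time \<open>k\<close> gives the kernel evaluated at \<open>S k\<close>.\<close>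

definition kendall_random_walk ::
  "real \<Rightarrow> real measure \<Rightarrow> 'a measure \<Rightarrow> (nat \<Rightarrow> 'a \<Rightarrow> real) \<Rightarrow> bool" where
  "kendall_random_walk \<alpha> \<nu> M S \<longleftrightarrow>
     prob_space M \<and>
     (\<forall>n\<ge>1. S n \<in> measurable M borel_nonneg) \<and>
     distr M borel_nonneg (S 1) = \<nu> \<and>
     (\<forall>k\<ge>1. \<forall>n>k. \<forall>A\<in>sets borel_nonneg.
        AE \<omega> in M. real_cond_exp M (history M S k) (indicator (S n -` A \<inter> space M)) \<omega>
          = measure (kendall_conv \<alpha> (return borel_nonneg (S k \<omega>)) (kendall_power \<alpha> \<nu> (n - k))) A)"

text \<open>In \<open>enat\<close> the infimum of the empty set is \<open>\<infinity>\<close>.\<close>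

definition renewal_process :: "(nat \<Rightarrow> 'a \<Rightarrow> real) \<Rightarrow> real \<Rightarrow> 'a \<Rightarrow> enat" where
  "renewal_process S t \<omega> = Inf {enat n | n. S (n + 1) \<omega> > t}"

definition renewal_function :: "'a measure \<Rightarrow> (nat \<Rightarrow> 'a \<Rightarrow> real) \<Rightarrow> real \<Rightarrow> ennreal" where
  "renewal_function M S t = (\<integral>\<^sup>+\<omega>. ennreal_of_enat (renewal_process S t \<omega>) \<partial>M)"

section \<open>Tail, transform and truncated moment of the step distribution\<close>

definition F_bar :: "real measure \<Rightarrow> real \<Rightarrow> real" where
  "F_bar \<nu> t = measure \<nu> {x \<in> space \<nu>. t < x}"

definition G :: "real \<Rightarrow> real measure \<Rightarrow> real \<Rightarrow> real" where
  "G \<alpha> \<nu> t = (\<integral>x. max (1 - x powr \<alpha> / t powr \<alpha>) 0 \<partial>\<nu>)"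

definition G_bar :: "real \<Rightarrow> real measure \<Rightarrow> real \<Rightarrow> real" where
  "G_bar \<alpha> \<nu> t = 1 - G \<alpha> \<nu> t"

definition H :: "real \<Rightarrow> real measure \<Rightarrow> real \<Rightarrow> real" where
  "H \<alpha> \<nu> t = (LINT x:{0..t}|\<nu>. x powr \<alpha>)"

definition moment :: "real \<Rightarrow> real measure \<Rightarrow> ennreal" where
  "moment \<alpha> \<nu> = (\<integral>\<^sup>+x. ennreal (x powr \<alpha>) \<partial>\<nu>)"

definition RV\<^sub>0 :: "(real \<Rightarrow> real) set" where
  "RV\<^sub>0 = {f \<in> borel_measurable borel.
     (\<forall>\<^sub>F t in at_top. 0 < f t) \<and> (\<forall>x>0. ((\<lambda>t. f (t * x) / f t) \<longlongrightarrow> 1) at_top)}"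

end

theory Submission
  imports Defs
begin

text \<open>
  For a probability measure \<open>\<mu>\<close> put \<open>g = \<integral> (1 - x\<^sup>\<alpha>/t\<^sup>\<alpha>)\<^sub>+ d\<mu>\<close> and \<open>h = \<integral>\<^bsub>[0,t]\<^esub> x\<^sup>\<alpha>/t\<^sup>\<alpha> d\<mu>\<close>, so that
  \<open>\<mu>[0,t] = g + h\<close>. On pairs of point masses one computes that the dual number \<open>g + \<epsilon> h\<close>
  (with \<open>\<epsilon>\<^sup>2 = 0\<close>) is multiplicative under the Kendall convolution, hence the \<open>n\<close>-th convolution power
  of \<open>\<nu>\<close> gives mass \<open>g\<^sup>n + n g\<^sup>n\<^sup>-\<^sup>1 h\<close> to \<open>[0,t]\<close>. The walk is almost surely nondecreasing, because
  \<open>\<delta>\<^sub>x\<close> convolved with anything lives on \<open>[x,\<infinity>)\<close>; therefore \<open>R(t)\<close> is the sum of these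
  masses over \<open>n \<ge> 1\<close>, that is \<open>g/(1 - g) + h/(1 - g)\<^sup>2\<close> with \<open>g = G(t)\<close> and \<open>h = H(t)/t\<^sup>\<alpha>\<close>.
  Since \<open>t\<^sup>\<alpha>(1 - G(t)) = t\<^sup>\<alpha> F_bar(t) + H(t)\<close> tends to the moment \<open>m\<close> by dominated convergence,
  \<open>t\<^sup>-\<^sup>\<alpha> R(t)\<close> tends to \<open>1/m + m/m\<^sup>2\<close>.
\<close>

section \<open>Integrals of the Kendall kernel\<close>

text \<open>As \<open>x / 0 = 0\<close> and \<open>0 powr \<alpha> = 0\<close>, the formulas below for the Kendall kernel also hold for
  \<open>t \<le> 0\<close>; this is what makes them cover the whole generator \<open>{0..t}\<close>, \<open>t\<close> real, of the
  sigma-algebra.\<close>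


definition williamson :: "real \<Rightarrow> real \<Rightarrow> real \<Rightarrow> real" where
  "williamson \<alpha> t x = indicator {0..t} x * (1 - (x / t) powr \<alpha>)"

definition truncated_power :: "real \<Rightarrow> real \<Rightarrow> real \<Rightarrow> real" where
  "truncated_power \<alpha> t x = indicator {0..t} x * (x / t) powr \<alpha>"

lemma williamson_measurable [measurable]: "williamson \<alpha> t \<in> borel_measurable borel"
  unfolding williamson_def by measurable

lemma truncated_power_measurable [measurable]: "truncated_power \<alpha> t \<in> borel_measurable borel"
  unfolding truncated_power_def by measurable

lemma williamson_nonneg:
  assumes "0 \<le> \<alpha>"
  shows "0 \<le> williamson \<alpha> t x"
proof (cases "x \<in> {0..t}")
  case True
  then have "x / t \<le> 1" by (cases "t = 0") auto
  then show ?thesis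
    using True assms by (simp add: williamson_def powr_le1)
qed (simp add: williamson_def)

lemma truncated_power_nonneg: "0 \<le> truncated_power \<alpha> t x"
  by (simp add: truncated_power_def)

lemma williamson_add_truncated_power:
  "williamson \<alpha> t x + truncated_power \<alpha> t x = indicator {0..t} x"
  by (simp add: williamson_def truncated_power_def indicator_def)

lemma space_borel_nonneg [simp]: "space borel_nonneg = {0..}"
  by (simp add: space_restrict_space)

lemma P_plus_iff: "\<mu> \<in> P_plus \<longleftrightarrow> sets \<mu> = sets borel_nonneg \<and> prob_space \<mu>"
  by (simp add: space_prob_algebra)

lemma space_P_plus: "\<mu> \<in> P_plus \<Longrightarrow> space \<mu> = {0..}"
  using sets_eq_imp_space_eq[of \<mu> borel_nonneg] by (simp add: P_plus_iff)

lemma borel_measurable_P_plus: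
  fixes f :: "real \<Rightarrow> real"
  assumes "\<nu> \<in> P_plus" "f \<in> borel_measurable borel"
  shows "f \<in> borel_measurable \<nu>"
proof -
  have "measurable \<nu> (borel :: real measure) = measurable borel_nonneg borel"
    using assms(1) by (intro measurable_cong_sets) (auto simp: P_plus_iff)
  then show ?thesis
    using measurable_restrict_space1[OF assms(2), of "{0..}"] by simp
qed

lemma williamson_measurable_P_plus:
  assumes "\<mu> \<in> P_plus"
  shows "williamson \<alpha> t \<in> borel_measurable \<mu>" "truncated_power \<alpha> t \<in> borel_measurable \<mu>"
  by (rule borel_measurable_P_plus[OF assms], measurable)+

text \<open>For \<open>t > 0\<close> this is the Williamson transform of \<open>\<mu>\<close> at
  \<open>1 / t\<close>, which is to the Kendall convolution what the characteristic function is to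
  the ordinary one. Values in \<open>ennreal\<close> spare integrability side conditions in the
  product formulas.\<close>

definition williamson_transform :: "real \<Rightarrow> real \<Rightarrow> real measure \<Rightarrow> ennreal" where
  "williamson_transform \<alpha> t \<mu> = (\<integral>\<^sup>+x. ennreal (williamson \<alpha> t x) \<partial>\<mu>)"

definition truncated_moment :: "real \<Rightarrow> real \<Rightarrow> real measure \<Rightarrow> ennreal" where
  "truncated_moment \<alpha> t \<mu> = (\<integral>\<^sup>+x. ennreal (truncated_power \<alpha> t x) \<partial>\<mu>)"

text \<open>The kernels add up to the indicator of \<open>{0..t}\<close>. Since these segments
  generate the sigma-algebra, the identity serves both for the measurability of the Kendall kernel
  and for the laws of the walk.\<close>

lemma emeasure_eq_williamson:
  assumes "\<alpha> > 0" "\<mu> \<in> P_plus"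
  shows "emeasure \<mu> {0..t} = williamson_transform \<alpha> t \<mu> + truncated_moment \<alpha> t \<mu>"
proof -
  note [measurable] = williamson_measurable_P_plus[OF assms(2)]
  have s: "{0..t} \<in> sets \<mu>"
    using assms(2) by (auto simp: P_plus_iff sets_restrict_space_iff)
  have "williamson_transform \<alpha> t \<mu> + truncated_moment \<alpha> t \<mu>
    = (\<integral>\<^sup>+x. ennreal (williamson \<alpha> t x + truncated_power \<alpha> t x) \<partial>\<mu>)"
    unfolding williamson_transform_def truncated_moment_def
    using assms(1) by (simp add: nn_integral_add williamson_nonneg truncated_power_nonneg)
  also have "\<dots> = (\<integral>\<^sup>+x. indicator {0..t} x \<partial>\<mu>)"
    by (simp add: williamson_add_truncated_power ennreal_indicator)
  finally show ?thesis using s by simp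
qed

section \<open>Integrals against the Pareto law\<close>

lemma nn_integral_pareto:
  assumes [measurable]: "f \<in> borel_measurable borel"
  shows "(\<integral>\<^sup>+z. ennreal (f z) \<partial>pareto \<beta>)
    = (\<integral>\<^sup>+z. ennreal (\<beta> * z powr (- \<beta> - 1) * indicator {1..} z) * ennreal (f z) \<partial>lborel)"
proof -
  have "(\<integral>\<^sup>+z. ennreal (f z) \<partial>pareto \<beta>)
    = (\<integral>\<^sup>+z. ennreal (\<beta> * z powr (- \<beta> - 1) * indicator {1..} z) * (ennreal (f z) * indicator {0..} z) \<partial>lborel)"
    unfolding pareto_def
    by (subst nn_integral_restrict_space) (auto intro!: nn_integral_density)
  \<comment> \<open>The cut at 0 left by \<open>restrict_space\<close> disappears because the
    density already vanishes below 1.\<close>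
  also have "\<dots> = (\<integral>\<^sup>+z. ennreal (\<beta> * z powr (- \<beta> - 1) * indicator {1..} z) * ennreal (f z) \<partial>lborel)"
    by (intro nn_integral_cong) (auto simp: indicator_def)
  finally show ?thesis .
qed

lemma sets_pareto [simp, measurable_cong]: "sets (pareto \<beta>) = sets borel_nonneg"
  by (simp add: pareto_def sets_restrict_space)

lemma space_pareto [simp]: "space (pareto \<beta>) = {0..}"
  by (simp add: pareto_def space_restrict_space)

lemma prob_space_pareto:
  assumes "\<beta> > 0"
  shows "prob_space (pareto \<beta>)"
proof
  \<comment> \<open>The function is an antiderivative of the density on \<open>{1..}\<close>; its
    limit is the boundary term at infinity.\<close>
  have "((\<lambda>x::real. - (x powr (- \<beta>))) \<longlongrightarrow> - 0) at_top"
    using assms by (intro tendsto_minus tendsto_neg_powr filterlim_ident) auto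
  then have lim: "((\<lambda>x::real. - (x powr (- \<beta>))) \<longlongrightarrow> 0) at_top"
    by simp
  have "emeasure (pareto \<beta>) (space (pareto \<beta>)) = (\<integral>\<^sup>+z. ennreal ((\<lambda>_. 1) z) \<partial>pareto \<beta>)"
    by simp
  also have "\<dots> = (\<integral>\<^sup>+z. ennreal (\<beta> * z powr (- \<beta> - 1)) * indicator {1..} z \<partial>lborel)"
    by (subst nn_integral_pareto) (auto intro!: nn_integral_cong simp: indicator_def)
  also have "\<dots> = ennreal (0 - (- ((1::real) powr (- \<beta>))))"
    using assms lim
    by (intro nn_integral_FTC_atLeast) (auto intro!: derivative_eq_intros)
  finally show "emeasure (pareto \<beta>) (space (pareto \<beta>)) = 1"
    by simp
qed

lemma nn_integral_pareto_williamson: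
  assumes "\<alpha> > 0" "0 < y" "y \<le> t"
  shows "(\<integral>\<^sup>+z. ennreal (williamson \<alpha> t (y * z)) \<partial>pareto (2 * \<alpha>)) = ennreal ((1 - (y / t) powr \<alpha>)\<^sup>2)"
proof -
  define v where "v = (y / t) powr \<alpha>"
  \<comment> \<open>An antiderivative of the integrand on \<open>{1..t / y}\<close>; beyond
    \<open>t / y\<close> the factor \<open>williamson\<close> vanishes.\<close>
  define A where "A z = 2 * v * z powr (- \<alpha>) - z powr (- 2 * \<alpha>)" for z
  have t: "t > 0" and T: "1 \<le> t / y" using assms by auto
  have "(\<integral>\<^sup>+z. ennreal (williamson \<alpha> t (y * z)) \<partial>pareto (2 * \<alpha>))
      = (\<integral>\<^sup>+z. ennreal (2 * \<alpha> * z powr (- 2 * \<alpha> - 1) * (1 - (y * z / t) powr \<alpha>)) * indicator {1..t / y} z \<partial>lborel)"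
    using assms t
    by (subst nn_integral_pareto)
       (auto intro!: nn_integral_cong simp: indicator_def williamson_def field_simps
             simp flip: ennreal_mult')
  also have "\<dots> = ennreal (A (t / y) - A 1)"
  proof (rule nn_integral_FTC_Icc)
    fix z assume "z \<in> {1..t / y}"
    then have z: "1 \<le> z" "z \<le> t / y" by auto
    have pz: "(y * z / t) powr \<alpha> = v * z powr \<alpha>"
      using assms z t by (simp add: v_def powr_mult powr_divide)
    have e: "z powr (- 2 * \<alpha> - 1) * z powr \<alpha> = z powr (- \<alpha> - 1)"
      using z by (simp flip: powr_add)
    have "(A has_real_derivative (2 * v * (- \<alpha> * z powr (- \<alpha> - 1)) - (- 2 * \<alpha>) * z powr (- 2 * \<alpha> - 1))) (at z)"
      unfolding A_def using z by (auto intro!: derivative_eq_intros)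
    also have "2 * v * (- \<alpha> * z powr (- \<alpha> - 1)) - (- 2 * \<alpha>) * z powr (- 2 * \<alpha> - 1)
        = 2 * \<alpha> * z powr (- 2 * \<alpha> - 1) * (1 - (y * z / t) powr \<alpha>)"
      unfolding pz e[symmetric] by (simp add: algebra_simps)
    finally show "(A has_real_derivative 2 * \<alpha> * z powr (- 2 * \<alpha> - 1) * (1 - (y * z / t) powr \<alpha>)) (at z)" .
    have "(y * z / t) powr \<alpha> \<le> 1"
      using assms z t by (intro powr_le1) (auto simp: field_simps)
    then show "0 \<le> 2 * \<alpha> * z powr (- 2 * \<alpha> - 1) * (1 - (y * z / t) powr \<alpha>)"
      using assms by simp
  qed (use T in auto)
  also have "A (t / y) - A 1 = (1 - v)\<^sup>2"
  proof -
    \<comment> \<open>At the upper end the power of \<open>z\<close> turns back into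
      \<open>v\<close>, so \<open>A (t / y)\<close> is the square of \<open>v\<close>, while
      \<open>A 1 = 2 * v - 1\<close>.\<close>
    have e1: "(t / y) powr (- \<alpha>) = v"
      using assms t by (simp add: v_def powr_minus powr_divide)
    have e2: "(t / y) powr (- 2 * \<alpha>) = v\<^sup>2"
      unfolding e1[symmetric] power2_eq_square by (simp flip: powr_add)
    show ?thesis
      unfolding A_def e1 e2 by (simp add: power2_eq_square algebra_simps)
  qed
  finally show ?thesis by (simp add: v_def)
qed

lemma nn_integral_pareto_truncated_power:
  assumes "\<alpha> > 0" "0 < y" "y \<le> t"
  shows "(\<integral>\<^sup>+z. ennreal (truncated_power \<alpha> t (y * z)) \<partial>pareto (2 * \<alpha>))
    = ennreal (2 * (y / t) powr \<alpha> * (1 - (y / t) powr \<alpha>))"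
proof -
  define v where "v = (y / t) powr \<alpha>"
  \<comment> \<open>Once the powers are merged the integrand is
    \<open>2 * \<alpha> * v * z powr (- \<alpha> - 1)\<close>, and this is an antiderivative of
    it.\<close>
  define A where "A z = - (2 * v * z powr (- \<alpha>))" for z
  have t: "t > 0" and T: "1 \<le> t / y" using assms by auto
  have "(\<integral>\<^sup>+z. ennreal (truncated_power \<alpha> t (y * z)) \<partial>pareto (2 * \<alpha>))
      = (\<integral>\<^sup>+z. ennreal (2 * \<alpha> * z powr (- 2 * \<alpha> - 1) * (y * z / t) powr \<alpha>) * indicator {1..t / y} z \<partial>lborel)"
    using assms t
    by (subst nn_integral_pareto)
       (auto intro!: nn_integral_cong simp: indicator_def truncated_power_def field_simps
             simp flip: ennreal_mult')
  also have "\<dots> = ennreal (A (t / y) - A 1)"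
  proof (rule nn_integral_FTC_Icc)
    fix z assume "z \<in> {1..t / y}"
    then have z: "1 \<le> z" "z \<le> t / y" by auto
    have pz: "(y * z / t) powr \<alpha> = v * z powr \<alpha>"
      using assms z t by (simp add: v_def powr_mult powr_divide)
    have e: "z powr (- 2 * \<alpha> - 1) * z powr \<alpha> = z powr (- \<alpha> - 1)"
      using z by (simp flip: powr_add)
    have "(A has_real_derivative (- (2 * v * (- \<alpha> * z powr (- \<alpha> - 1))))) (at z)"
      unfolding A_def using z by (auto intro!: derivative_eq_intros)
    also have "- (2 * v * (- \<alpha> * z powr (- \<alpha> - 1))) = 2 * \<alpha> * z powr (- 2 * \<alpha> - 1) * (y * z / t) powr \<alpha>"
      unfolding pz e[symmetric] by (simp add: algebra_simps)
    finally show "(A has_real_derivative 2 * \<alpha> * z powr (- 2 * \<alpha> - 1) * (y * z / t) powr \<alpha>) (at z)" .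
  qed (use T assms in auto)
  also have "A (t / y) - A 1 = 2 * v * (1 - v)"
  proof -
    have e1: "(t / y) powr (- \<alpha>) = v"
      using assms t by (simp add: v_def powr_minus powr_divide)
    show ?thesis
      unfolding A_def e1 by (simp add: algebra_simps)
  qed
  finally show ?thesis by (simp add: v_def)
qed

section \<open>The Kendall kernel on pairs of point masses\<close>

lemma pareto_in_P_plus: "\<beta> > 0 \<Longrightarrow> pareto \<beta> \<in> P_plus"
  by (simp add: P_plus_iff prob_space_pareto)

lemma return_in_P_plus: "0 \<le> x \<Longrightarrow> return borel_nonneg x \<in> P_plus"
  by (simp add: P_plus_iff prob_space_return)

text \<open>\<open>measure_of\<close> returns the prescribed set function only if that function is a
  measure. Instead of checking countable additivity by hand, the proof identifies
  \<open>kendall_unit\<close> with a Bernoulli mixture formed by the monadic bind, from which both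
  claims are inherited.\<close>

lemma
  assumes "\<alpha> > 0" "0 \<le> x" "x \<le> 1"
  shows kendall_unit_in_P_plus: "kendall_unit \<alpha> x \<in> P_plus"
    and nn_integral_kendall_unit: "f \<in> borel_measurable borel_nonneg \<Longrightarrow>
      (\<integral>\<^sup>+z. f z \<partial>kendall_unit \<alpha> x)
       = ennreal (1 - x powr \<alpha>) * f 1 + ennreal (x powr \<alpha>) * (\<integral>\<^sup>+z. f z \<partial>pareto (2 * \<alpha>))"
proof -
  let ?k = "\<lambda>b. if b then pareto (2 * \<alpha>) else return borel_nonneg 1"
  let ?p = "bernoulli_pmf (x powr \<alpha>)"
  let ?B = "measure_pmf ?p \<bind> ?k"
  have p: "0 \<le> x powr \<alpha>" "x powr \<alpha> \<le> 1"
    using assms by (auto intro: powr_le1)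
  have k: "?k \<in> measure_pmf ?p \<rightarrow>\<^sub>M prob_algebra borel_nonneg"
    using pareto_in_P_plus[of "2 * \<alpha>"] return_in_P_plus[of 1] assms by auto
  note ks = measurable_prob_algebraD[OF k]
  \<comment> \<open>The Bernoulli law is viewed as a constant kernel on a one-point space, so that
    membership in \<open>P_plus\<close> becomes a case of measurability of a bind.\<close>
  have B: "?B \<in> P_plus"
    using measurable_bind_prob_space[OF measurable_const[of "measure_pmf ?p" _ "count_space {()}"] k]
    by (auto simp: measurable_def space_prob_algebra prob_space_measure_pmf)
  have sB: "sets ?B = sets borel_nonneg" and spB: "space ?B = {0..}"
    using B sets_eq_imp_space_eq[of ?B borel_nonneg] by (simp_all add: P_plus_iff)
  have nn: "(\<integral>\<^sup>+z. f z \<partial>?B)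
      = ennreal (1 - x powr \<alpha>) * f 1 + ennreal (x powr \<alpha>) * (\<integral>\<^sup>+z. f z \<partial>pareto (2 * \<alpha>))"
    if "f \<in> borel_measurable borel_nonneg" for f
    using p that by (simp add: nn_integral_bind[OF that ks] nn_integral_return add.commute mult.commute)
  have em: "emeasure ?B A = ennreal (1 - x powr \<alpha>) * emeasure (return borel_nonneg 1) A
        + ennreal (x powr \<alpha>) * emeasure (pareto (2 * \<alpha>)) A" if "A \<in> sets borel_nonneg" for A
    using nn[of "indicator A"] that sB by (simp add: emeasure_return)
  have "kendall_unit \<alpha> x = measure_of (space ?B) (sets ?B) (emeasure ?B)"
    unfolding kendall_unit_def spB sB
    by (rule measure_of_eq) (use em sets.sigma_sets_eq[of borel_nonneg] sets.space_closed[of borel_nonneg] in auto)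
  then have eq: "kendall_unit \<alpha> x = ?B"
    unfolding measure_of_of_measure .
  show "kendall_unit \<alpha> x \<in> P_plus"
    unfolding eq by (rule B)
  show "f \<in> borel_measurable borel_nonneg \<Longrightarrow>
      (\<integral>\<^sup>+z. f z \<partial>kendall_unit \<alpha> x)
       = ennreal (1 - x powr \<alpha>) * f 1 + ennreal (x powr \<alpha>) * (\<integral>\<^sup>+z. f z \<partial>pareto (2 * \<alpha>))"
    unfolding eq by (rule nn)
qed

text \<open>This symmetry lets \<open>linorder_wlog\<close> reduce claims about the kernel to
  \<open>x \<le> y\<close>, where the scale is \<open>y\<close>.\<close>

lemma kendall_dirac_commute: "kendall_dirac \<alpha> x y = kendall_dirac \<alpha> y x"
  by (simp add: kendall_dirac_def max.commute min.commute)

lemma kendall_dirac_eq_distr: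
  assumes "0 \<le> x" "x \<le> y" "0 < y"
  shows "kendall_dirac \<alpha> x y = distr (kendall_unit \<alpha> (x / y)) borel_nonneg (\<lambda>z. y * z)"
  using assms by (simp add: kendall_dirac_def max_def min_def)

lemma measurable_scale_borel_nonneg [measurable]:
  "0 \<le> y \<Longrightarrow> (\<lambda>z::real. y * z) \<in> borel_nonneg \<rightarrow>\<^sub>M borel_nonneg"
  by (intro measurable_restrict_space3) auto

lemma kendall_dirac_in_P_plus:
  assumes "\<alpha> > 0" "0 \<le> x" "0 \<le> y"
  shows "kendall_dirac \<alpha> x y \<in> P_plus"
  using assms(2,3)
proof (induction x y rule: linorder_wlog)
  case (le x y)
  show ?case
  proof (cases "y = 0")
    case True
    then show ?thesis
      using le return_in_P_plus by (simp add: kendall_dirac_def)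
  next
    case False
    then have "kendall_unit \<alpha> (x / y) \<in> P_plus"
      using assms le by (intro kendall_unit_in_P_plus) auto
    then interpret prob_space "kendall_unit \<alpha> (x / y)"
      by (simp add: P_plus_iff)
    have [measurable_cong]: "sets (kendall_unit \<alpha> (x / y)) = sets borel_nonneg"
      using \<open>kendall_unit \<alpha> (x / y) \<in> P_plus\<close> by (simp add: P_plus_iff)
  have [measurable]: "(\<lambda>z. y * z) \<in> kendall_unit \<alpha> (x / y) \<rightarrow>\<^sub>M borel_nonneg"
    using measurable_scale_borel_nonneg[of y] le
    by (simp add: measurable_cong_sets[OF \<open>sets (kendall_unit \<alpha> (x / y)) = sets borel_nonneg\<close> refl])
    show ?thesis
      using le False by (simp add: kendall_dirac_eq_distr P_plus_iff prob_space_distr)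
  qed
qed (simp add: kendall_dirac_commute)

lemma nn_integral_kendall_dirac:
  fixes f :: "real \<Rightarrow> real"
  assumes "\<alpha> > 0" "0 \<le> x" "x \<le> y" "0 < y" and f [measurable]: "f \<in> borel_measurable borel"
  shows "(\<integral>\<^sup>+z. ennreal (f z) \<partial>kendall_dirac \<alpha> x y)
    = ennreal (1 - (x / y) powr \<alpha>) * ennreal (f y)
      + ennreal ((x / y) powr \<alpha>) * (\<integral>\<^sup>+z. ennreal (f (y * z)) \<partial>pareto (2 * \<alpha>))"
proof -
  have "kendall_unit \<alpha> (x / y) \<in> P_plus"
    using assms by (intro kendall_unit_in_P_plus) auto
  then have [measurable_cong]: "sets (kendall_unit \<alpha> (x / y)) = sets borel_nonneg"
    by (simp add: P_plus_iff)
  have [measurable]: "(\<lambda>z. y * z) \<in> kendall_unit \<alpha> (x / y) \<rightarrow>\<^sub>M borel_nonneg"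
    using measurable_scale_borel_nonneg[of y] assms
    by (simp add: measurable_cong_sets[OF \<open>sets (kendall_unit \<alpha> (x / y)) = sets borel_nonneg\<close> refl])
  have "(\<integral>\<^sup>+z. ennreal (f z) \<partial>kendall_dirac \<alpha> x y) = (\<integral>\<^sup>+z. ennreal (f (y * z)) \<partial>kendall_unit \<alpha> (x / y))"
    using assms by (simp add: kendall_dirac_eq_distr nn_integral_distr measurable_restrict_space1)
  also have "\<dots> = ennreal (1 - (x / y) powr \<alpha>) * ennreal (f (y * 1))
      + ennreal ((x / y) powr \<alpha>) * (\<integral>\<^sup>+z. ennreal (f (y * z)) \<partial>pareto (2 * \<alpha>))"
    using assms by (intro nn_integral_kendall_unit) (auto intro!: measurable_restrict_space1)
  finally show ?thesis by simp
qed

text \<open>The atom sits at \<open>y\<close> and the Pareto part is scaled by \<open>y\<close>, so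
  the kernel has no mass below the larger of its two arguments.\<close>

lemma nn_integral_kendall_dirac_eq_0:
  fixes f :: "real \<Rightarrow> real"
  assumes "\<alpha> > 0" "0 \<le> x" "x \<le> y" "0 < y" "t < y"
    and [measurable]: "f \<in> borel_measurable borel" and f: "\<And>z. t < z \<Longrightarrow> f z = 0"
  shows "(\<integral>\<^sup>+z. ennreal (f z) \<partial>kendall_dirac \<alpha> x y) = 0"
proof -
  have "f (y * z) = 0" if "1 \<le> z" for z
  proof (rule f)
    have "y * 1 \<le> y * z"
      using that assms(4) by (intro mult_left_mono) auto
    then show "t < y * z"
      using assms(5) by linarith
  qed
  then have "(\<integral>\<^sup>+z. ennreal (f (y * z)) \<partial>pareto (2 * \<alpha>)) = 0"
    by (subst nn_integral_pareto) (auto simp: nn_integral_0_iff_AE indicator_def)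
  then show ?thesis
    using assms by (simp add: nn_integral_kendall_dirac)
qed

lemma powr_ratio_mult:
  fixes x y t :: real
  assumes "0 \<le> x" "0 < y" "0 < t"
  shows "(x / y) powr \<alpha> * (y / t) powr \<alpha> = (x / t) powr \<alpha>"
  using assms by (simp flip: powr_mult)

text \<open>The Pareto index \<open>2 * \<alpha>\<close> makes the continuous part contribute the
  square of \<open>1 - v\<close>. With \<open>u = r * v\<close> the mixture
  \<open>(1 - r) * (1 - v)\<close> plus \<open>r\<close> times that square then factors as
  \<open>(1 - u) * (1 - v)\<close>.\<close>

lemma nn_integral_kendall_dirac_williamson:
  assumes "\<alpha> > 0" "0 \<le> x" "0 \<le> y"
  shows "(\<integral>\<^sup>+z. ennreal (williamson \<alpha> t z) \<partial>kendall_dirac \<alpha> x y)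
    = ennreal (williamson \<alpha> t x * williamson \<alpha> t y)"
  using assms(2,3)
proof (induction x y rule: linorder_wlog)
  case (le x y)
  consider "y = 0" | "0 < y" "t < y" | "0 < y" "y \<le> t"
    using le by linarith
  then show ?case
  proof cases
    \<comment> \<open>Here \<open>x = 0\<close> as well and the kernel is the point mass at 0. The
      value of \<open>williamson\<close> at 0 is 0 or 1 according to the sign of \<open>t\<close>,
      hence equal to its own square.\<close>
    case 1
    then show ?thesis
      using le by (simp add: kendall_dirac_def nn_integral_return measurable_restrict_space1 williamson_def indicator_def)
  next
    case 2
    then have "williamson \<alpha> t y = 0" by (simp add: williamson_def)
    moreover have "(\<integral>\<^sup>+z. ennreal (williamson \<alpha> t z) \<partial>kendall_dirac \<alpha> x y) = 0"
      using assms(1) le 2 by (intro nn_integral_kendall_dirac_eq_0[where t=t]) (auto simp: williamson_def)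
    ultimately show ?thesis by simp
  next
    case 3
    define u v r where "u = (x / t) powr \<alpha>" and "v = (y / t) powr \<alpha>" and "r = (x / y) powr \<alpha>"
    have u: "u = r * v"
      using le 3 by (simp add: u_def v_def r_def powr_ratio_mult)
    have b: "0 \<le> v" "v \<le> 1" "0 \<le> r" "r \<le> 1"
      using le 3 assms(1) by (auto simp: v_def r_def intro!: powr_le1)
    have w: "williamson \<alpha> t x = 1 - u" "williamson \<alpha> t y = 1 - v"
      using le 3 by (auto simp: williamson_def u_def v_def)
    have "(\<integral>\<^sup>+z. ennreal (williamson \<alpha> t z) \<partial>kendall_dirac \<alpha> x y)
      = ennreal (1 - r) * ennreal (1 - v) + ennreal r * ennreal ((1 - v)\<^sup>2)"
      using assms(1) le 3 w by (simp add: nn_integral_kendall_dirac nn_integral_pareto_williamson r_def v_def)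
    also have "\<dots> = ennreal ((1 - r) * (1 - v) + r * (1 - v)\<^sup>2)"
      using b by (simp flip: ennreal_mult ennreal_plus)
    also have "(1 - r) * (1 - v) + r * (1 - v)\<^sup>2 = (1 - u) * (1 - v)"
      unfolding u by (simp add: power2_eq_square algebra_simps)
    finally show ?thesis by (simp add: w)
  qed
qed (simp add: kendall_dirac_commute mult.commute)

text \<open>The Leibniz rule that accompanies the product formula for \<open>williamson\<close>: the
  mixture \<open>(1 - r) * v + r * (2 * v * (1 - v))\<close> equals
  \<open>(1 - u) * v + u * (1 - v)\<close> because \<open>u = r * v\<close>.\<close>

lemma nn_integral_kendall_dirac_truncated_power:
  assumes "\<alpha> > 0" "0 \<le> x" "0 \<le> y"
  shows "(\<integral>\<^sup>+z. ennreal (truncated_power \<alpha> t z) \<partial>kendall_dirac \<alpha> x y)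
    = ennreal (williamson \<alpha> t x * truncated_power \<alpha> t y + truncated_power \<alpha> t x * williamson \<alpha> t y)"
  using assms(2,3)
proof (induction x y rule: linorder_wlog)
  case (le x y)
  consider "y = 0" | "0 < y" "t < y" | "0 < y" "y \<le> t"
    using le by linarith
  then show ?case
  proof cases
    case 1
    then show ?thesis
      using le by (simp add: kendall_dirac_def nn_integral_return measurable_restrict_space1 truncated_power_def)
  next
    case 2
    then have "williamson \<alpha> t y = 0" "truncated_power \<alpha> t y = 0"
      by (simp_all add: williamson_def truncated_power_def)
    moreover have "(\<integral>\<^sup>+z. ennreal (truncated_power \<alpha> t z) \<partial>kendall_dirac \<alpha> x y) = 0"
      using assms(1) le 2 by (intro nn_integral_kendall_dirac_eq_0[where t=t]) (auto simp: truncated_power_def)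
    ultimately show ?thesis by simp
  next
    case 3
    define u v r where "u = (x / t) powr \<alpha>" and "v = (y / t) powr \<alpha>" and "r = (x / y) powr \<alpha>"
    have u: "u = r * v"
      using le 3 by (simp add: u_def v_def r_def powr_ratio_mult)
    have b: "0 \<le> v" "v \<le> 1" "0 \<le> r" "r \<le> 1"
      using le 3 assms(1) by (auto simp: v_def r_def intro!: powr_le1)
    have w: "williamson \<alpha> t x = 1 - u" "williamson \<alpha> t y = 1 - v"
      "truncated_power \<alpha> t x = u" "truncated_power \<alpha> t y = v"
      using le 3 by (auto simp: williamson_def truncated_power_def u_def v_def)
    have "(\<integral>\<^sup>+z. ennreal (truncated_power \<alpha> t z) \<partial>kendall_dirac \<alpha> x y)
      = ennreal (1 - r) * ennreal v + ennreal r * ennreal (2 * v * (1 - v))"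
      using assms(1) le 3 w by (simp add: nn_integral_kendall_dirac nn_integral_pareto_truncated_power r_def v_def)
    also have "\<dots> = ennreal ((1 - r) * v + r * (2 * v * (1 - v)))"
      using b by (simp flip: ennreal_mult ennreal_plus)
    also have "(1 - r) * v + r * (2 * v * (1 - v)) = (1 - u) * v + u * (1 - v)"
      unfolding u by (simp add: algebra_simps)
    finally show ?thesis by (simp add: w)
  qed
qed (simp add: kendall_dirac_commute mult.commute add.commute)

section \<open>Measurability of the kernel\<close>

lemma sets_borel_nonneg_eq: "sets borel_nonneg = sigma_sets {0..} (range (\<lambda>t::real. {0..t}))"
proof -
  have b: "sets (borel :: real measure) = sigma_sets UNIV (range atMost)"
    unfolding borel_eq_atMost by simp
  then have "{0..} \<in> sigma_sets UNIV (range (atMost :: real \<Rightarrow> _))"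
    by (metis borel_closed closed_atLeast)
  then have "sets borel_nonneg = sigma_sets {0..} ((\<inter>) {0..} ` range atMost)"
    unfolding sets_restrict_space b by (rule sigma_sets_Int) simp
  also have "(\<inter>) {0..} ` range atMost = range (\<lambda>t::real. {0..t})"
    by (auto simp: image_image atLeastAtMost_def)
  finally show ?thesis .
qed

text \<open>Joint measurability has to be checked only on the intersection-stable generator
  \<open>{0..t}\<close>. There the mass is a polynomial in \<open>williamson\<close> and
  \<open>truncated_power\<close> of the two coordinates.\<close>

lemma kendall_dirac_measurable:
  assumes "\<alpha> > 0"
  shows "(\<lambda>(x, y). kendall_dirac \<alpha> x y) \<in> borel_nonneg \<Otimes>\<^sub>M borel_nonneg \<rightarrow>\<^sub>M prob_algebra borel_nonneg"
proof (rule measurable_prob_algebra_generated[OF sets_borel_nonneg_eq])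
  show "Int_stable (range (\<lambda>t::real. {0..t}))"
    by (auto simp: Int_stable_def)
  show "prob_space (case a of (x, y) \<Rightarrow> kendall_dirac \<alpha> x y)"
    "sets (case a of (x, y) \<Rightarrow> kendall_dirac \<alpha> x y) = sets borel_nonneg"
    if "a \<in> space (borel_nonneg \<Otimes>\<^sub>M borel_nonneg)" for a
    using kendall_dirac_in_P_plus[OF assms, of "fst a" "snd a"] that
    by (auto simp: P_plus_iff space_pair_measure split: prod.split)
  fix A :: "real set" assume "A \<in> range (\<lambda>t. {0..t})"
  then obtain t where A: "A = {0..t}" by auto
  have [measurable]: "williamson \<alpha> t \<in> borel_measurable borel_nonneg"
    "truncated_power \<alpha> t \<in> borel_measurable borel_nonneg"
    by (auto intro!: measurable_restrict_space1)
  have "(\<lambda>p. ennreal (williamson \<alpha> t (fst p) * williamson \<alpha> t (snd p))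
      + ennreal (williamson \<alpha> t (fst p) * truncated_power \<alpha> t (snd p) + truncated_power \<alpha> t (fst p) * williamson \<alpha> t (snd p)))
      \<in> borel_measurable (borel_nonneg \<Otimes>\<^sub>M borel_nonneg)"
    by measurable
  then show "(\<lambda>a. emeasure (case a of (x, y) \<Rightarrow> kendall_dirac \<alpha> x y) A) \<in> borel_measurable (borel_nonneg \<Otimes>\<^sub>M borel_nonneg)"
  proof (rule measurable_cong[THEN iffD2, rotated])
    fix p assume "p \<in> space (borel_nonneg \<Otimes>\<^sub>M borel_nonneg)"
    then have p: "0 \<le> fst p" "0 \<le> snd p"
      by (auto simp: space_pair_measure)
    then show "emeasure (case p of (x, y) \<Rightarrow> kendall_dirac \<alpha> x y) A
      = ennreal (williamson \<alpha> t (fst p) * williamson \<alpha> t (snd p))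
      + ennreal (williamson \<alpha> t (fst p) * truncated_power \<alpha> t (snd p) + truncated_power \<alpha> t (fst p) * williamson \<alpha> t (snd p))"
      using assms p
      by (simp add: A case_prod_beta kendall_dirac_in_P_plus emeasure_eq_williamson[OF assms]
            williamson_transform_def truncated_moment_def nn_integral_kendall_dirac_williamson nn_integral_kendall_dirac_truncated_power)
  qed
qed auto


section \<open>Multiplicativity under the Kendall convolution\<close>

lemma kendall_bind_measurable:
  assumes "\<alpha> > 0" "\<mu>\<^sub>2 \<in> P_plus"
  shows "(\<lambda>x. \<mu>\<^sub>2 \<bind> (\<lambda>y. kendall_dirac \<alpha> x y)) \<in> borel_nonneg \<rightarrow>\<^sub>M prob_algebra borel_nonneg"
  using assms kendall_dirac_measurable by (intro measurable_bind_prob_space2) auto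

lemma kendall_dirac_measurable_right:
  assumes "\<alpha> > 0" "0 \<le> x"
  shows "(\<lambda>y. kendall_dirac \<alpha> x y) \<in> borel_nonneg \<rightarrow>\<^sub>M prob_algebra borel_nonneg"
  using measurable_compose[OF measurable_Pair1'[of x borel_nonneg borel_nonneg] kendall_dirac_measurable[OF assms(1)]]
    assms by simp

lemma kendall_conv_in_P_plus:
  assumes "\<alpha> > 0" "\<mu>\<^sub>1 \<in> P_plus" "\<mu>\<^sub>2 \<in> P_plus"
  shows "kendall_conv \<alpha> \<mu>\<^sub>1 \<mu>\<^sub>2 \<in> P_plus"
proof -
  \<comment> \<open>The convolution is treated as a kernel that ignores its argument; evaluation at
    0 then gives membership in \<open>P_plus\<close>.\<close>
  have "(\<lambda>_. kendall_conv \<alpha> \<mu>\<^sub>1 \<mu>\<^sub>2) \<in> borel_nonneg \<rightarrow>\<^sub>M prob_algebra borel_nonneg"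
    unfolding kendall_conv_def
    using assms by (intro measurable_bind_prob_space[OF measurable_const kendall_bind_measurable]) auto
  then show ?thesis
    by (auto dest: measurable_space[where x=0])
qed

lemma kendall_power_in_P_plus:
  assumes "\<alpha> > 0" "\<nu> \<in> P_plus"
  shows "kendall_power \<alpha> \<nu> n \<in> P_plus"
  using assms by (induction n) (simp_all add: return_in_P_plus kendall_conv_in_P_plus)

lemma nn_integral_kendall_conv:
  assumes "\<alpha> > 0" "\<mu>\<^sub>1 \<in> P_plus" "\<mu>\<^sub>2 \<in> P_plus" and f: "f \<in> borel_measurable borel_nonneg"
  shows "(\<integral>\<^sup>+z. f z \<partial>kendall_conv \<alpha> \<mu>\<^sub>1 \<mu>\<^sub>2) = (\<integral>\<^sup>+x. \<integral>\<^sup>+y. \<integral>\<^sup>+z. f z \<partial>kendall_dirac \<alpha> x y \<partial>\<mu>\<^sub>2 \<partial>\<mu>\<^sub>1)"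
proof -
  have s: "sets \<mu>\<^sub>1 = sets borel_nonneg" "sets \<mu>\<^sub>2 = sets borel_nonneg"
    using assms by (simp_all add: P_plus_iff)
  then have sp: "space \<mu>\<^sub>1 = {0..}"
    using sets_eq_imp_space_eq[OF s(1)] by simp
  have "(\<lambda>x. \<mu>\<^sub>2 \<bind> (\<lambda>y. kendall_dirac \<alpha> x y)) \<in> \<mu>\<^sub>1 \<rightarrow>\<^sub>M subprob_algebra borel_nonneg"
    using measurable_prob_algebraD[OF kendall_bind_measurable[OF assms(1,3)]] s
    by (simp cong: measurable_cong_sets)
  then have "(\<integral>\<^sup>+z. f z \<partial>kendall_conv \<alpha> \<mu>\<^sub>1 \<mu>\<^sub>2) = (\<integral>\<^sup>+x. \<integral>\<^sup>+z. f z \<partial>(\<mu>\<^sub>2 \<bind> kendall_dirac \<alpha> x) \<partial>\<mu>\<^sub>1)"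
    unfolding kendall_conv_def by (rule nn_integral_bind[OF f])
  also have "\<dots> = (\<integral>\<^sup>+x. \<integral>\<^sup>+y. \<integral>\<^sup>+z. f z \<partial>kendall_dirac \<alpha> x y \<partial>\<mu>\<^sub>2 \<partial>\<mu>\<^sub>1)"
  proof (intro nn_integral_cong nn_integral_bind[OF f])
    fix x assume "x \<in> space \<mu>\<^sub>1"
    then show "kendall_dirac \<alpha> x \<in> \<mu>\<^sub>2 \<rightarrow>\<^sub>M subprob_algebra borel_nonneg"
      using measurable_prob_algebraD[OF kendall_dirac_measurable_right[OF assms(1)]] s sp
      by (simp cong: measurable_cong_sets)
  qed
  finally show ?thesis .
qed

text \<open>The formula on point masses separates the variables, so the iterated integral
  factors.\<close>

lemma williamson_transform_kendall_conv:
  assumes "\<alpha> > 0" "\<mu>\<^sub>1 \<in> P_plus" "\<mu>\<^sub>2 \<in> P_plus"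
  shows "williamson_transform \<alpha> t (kendall_conv \<alpha> \<mu>\<^sub>1 \<mu>\<^sub>2) = williamson_transform \<alpha> t \<mu>\<^sub>1 * williamson_transform \<alpha> t \<mu>\<^sub>2"
proof -
  note [measurable] = williamson_measurable_P_plus[OF assms(2)] williamson_measurable_P_plus[OF assms(3)]
  have "williamson_transform \<alpha> t (kendall_conv \<alpha> \<mu>\<^sub>1 \<mu>\<^sub>2)
    = (\<integral>\<^sup>+x. \<integral>\<^sup>+y. \<integral>\<^sup>+z. ennreal (williamson \<alpha> t z) \<partial>kendall_dirac \<alpha> x y \<partial>\<mu>\<^sub>2 \<partial>\<mu>\<^sub>1)"
    unfolding williamson_transform_def
    using assms by (intro nn_integral_kendall_conv) (auto intro!: measurable_restrict_space1)
  also have "\<dots> = (\<integral>\<^sup>+x. \<integral>\<^sup>+y. ennreal (williamson \<alpha> t x) * ennreal (williamson \<alpha> t y) \<partial>\<mu>\<^sub>2 \<partial>\<mu>\<^sub>1)"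
    using assms
    by (intro nn_integral_cong)
       (simp add: space_P_plus nn_integral_kendall_dirac_williamson williamson_nonneg ennreal_mult)
  also have "\<dots> = williamson_transform \<alpha> t \<mu>\<^sub>1 * williamson_transform \<alpha> t \<mu>\<^sub>2"
    by (simp add: williamson_transform_def nn_integral_cmult nn_integral_multc)
  finally show ?thesis .
qed

lemma truncated_moment_kendall_conv:
  assumes "\<alpha> > 0" "\<mu>\<^sub>1 \<in> P_plus" "\<mu>\<^sub>2 \<in> P_plus"
  shows "truncated_moment \<alpha> t (kendall_conv \<alpha> \<mu>\<^sub>1 \<mu>\<^sub>2)
    = williamson_transform \<alpha> t \<mu>\<^sub>1 * truncated_moment \<alpha> t \<mu>\<^sub>2 + truncated_moment \<alpha> t \<mu>\<^sub>1 * williamson_transform \<alpha> t \<mu>\<^sub>2"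
proof -
  note [measurable] = williamson_measurable_P_plus[OF assms(2)] williamson_measurable_P_plus[OF assms(3)]
  have "truncated_moment \<alpha> t (kendall_conv \<alpha> \<mu>\<^sub>1 \<mu>\<^sub>2)
    = (\<integral>\<^sup>+x. \<integral>\<^sup>+y. \<integral>\<^sup>+z. ennreal (truncated_power \<alpha> t z) \<partial>kendall_dirac \<alpha> x y \<partial>\<mu>\<^sub>2 \<partial>\<mu>\<^sub>1)"
    unfolding truncated_moment_def
    using assms by (intro nn_integral_kendall_conv) (auto intro!: measurable_restrict_space1)
  also have "\<dots> = (\<integral>\<^sup>+x. \<integral>\<^sup>+y. ennreal (williamson \<alpha> t x) * ennreal (truncated_power \<alpha> t y)
      + ennreal (truncated_power \<alpha> t x) * ennreal (williamson \<alpha> t y) \<partial>\<mu>\<^sub>2 \<partial>\<mu>\<^sub>1)"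
    using assms
    by (intro nn_integral_cong)
       (simp add: space_P_plus nn_integral_kendall_dirac_truncated_power
          williamson_nonneg truncated_power_nonneg ennreal_mult)
  also have "\<dots> = williamson_transform \<alpha> t \<mu>\<^sub>1 * truncated_moment \<alpha> t \<mu>\<^sub>2
      + truncated_moment \<alpha> t \<mu>\<^sub>1 * williamson_transform \<alpha> t \<mu>\<^sub>2"
    by (simp add: williamson_transform_def truncated_moment_def nn_integral_add nn_integral_cmult nn_integral_multc)
  finally show ?thesis .
qed

lemma
  assumes "0 \<le> x"
  shows williamson_transform_return: "williamson_transform \<alpha> t (return borel_nonneg x) = ennreal (williamson \<alpha> t x)"
    and truncated_moment_return: "truncated_moment \<alpha> t (return borel_nonneg x) = ennreal (truncated_power \<alpha> t x)"
  using assms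
  by (simp_all add: williamson_transform_def truncated_moment_def nn_integral_return measurable_restrict_space1)

text \<open>The zeroth power is the point mass at 0, whose transform is 1 only for
  \<open>0 \<le> t\<close>.\<close>

lemma williamson_transform_kendall_power:
  assumes "\<alpha> > 0" "\<nu> \<in> P_plus" "0 \<le> t"
  shows "williamson_transform \<alpha> t (kendall_power \<alpha> \<nu> n) = williamson_transform \<alpha> t \<nu> ^ n"
  using assms
  by (induction n)
     (simp_all add: williamson_transform_return williamson_def williamson_transform_kendall_conv kendall_power_in_P_plus)

text \<open>The iterated Leibniz rule, formally the derivative of an \<open>n\<close>-th power. At
  \<open>n = 0\<close> the natural subtraction gives exponent 0, which the factor
  \<open>of_nat n\<close> makes harmless.\<close>

lemma truncated_moment_kendall_power:
  assumes "\<alpha> > 0" "\<nu> \<in> P_plus" "0 \<le> t"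
  shows "truncated_moment \<alpha> t (kendall_power \<alpha> \<nu> n)
    = of_nat n * williamson_transform \<alpha> t \<nu> ^ (n - 1) * truncated_moment \<alpha> t \<nu>"
proof (induction n)
  case 0
  then show ?case
    by (simp add: truncated_moment_return truncated_power_def)
next
  case (Suc n)
  have "truncated_moment \<alpha> t (kendall_power \<alpha> \<nu> (Suc n))
      = williamson_transform \<alpha> t \<nu> * truncated_moment \<alpha> t (kendall_power \<alpha> \<nu> n)
        + truncated_moment \<alpha> t \<nu> * williamson_transform \<alpha> t \<nu> ^ n"
    using assms
    by (simp add: truncated_moment_kendall_conv kendall_power_in_P_plus williamson_transform_kendall_power)
  then show ?case
    \<comment> \<open>The split on \<open>n\<close> resolves the truncated exponent
      \<open>n - 1\<close>.\<close>
    unfolding Suc.IH by (cases n) (simp_all add: algebra_simps)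
qed

text \<open>In this form both coefficients vanish for \<open>x > t\<close>, which yields
  monotonicity of the walk; integrated over \<open>x\<close> it yields the law after one more
  step.\<close>

lemma emeasure_kendall_conv_return:
  assumes "\<alpha> > 0" "\<mu> \<in> P_plus" "0 \<le> x"
  shows "emeasure (kendall_conv \<alpha> (return borel_nonneg x) \<mu>) {0..t}
    = ennreal (williamson \<alpha> t x) * emeasure \<mu> {0..t} + ennreal (truncated_power \<alpha> t x) * williamson_transform \<alpha> t \<mu>"
  using assms
  by (simp add: emeasure_eq_williamson[OF assms(1)] kendall_conv_in_P_plus return_in_P_plus
    williamson_transform_kendall_conv truncated_moment_kendall_conv williamson_transform_return truncated_moment_return algebra_simps)

section \<open>The renewal function as a series\<close>

lemma sigma_finite_subalgebra_history:
  assumes "kendall_random_walk \<alpha> \<nu> M S"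
  shows "sigma_finite_subalgebra M (history M S k)"
proof -
  have "prob_space M" and S: "\<And>n. n \<ge> 1 \<Longrightarrow> S n \<in> measurable M borel_nonneg"
    using assms by (auto simp: kendall_random_walk_def)
  let ?E = "\<Union>i\<in>{1..k}. {S i -` A \<inter> space M | A. A \<in> sets borel_nonneg}"
  have E: "?E \<subseteq> sets M"
    using measurable_sets[OF S] by auto
  then have "?E \<subseteq> Pow (space M)"
    using sets.space_closed by blast
  then have "subalgebra M (history M S k)"
    using sets.sigma_sets_subset[OF E] by (simp add: subalgebra_def history_def)
  then have "finite_measure_subalgebra M (history M S k)"
    using \<open>prob_space M\<close> prob_space.finite_measure
    by (auto simp: finite_measure_subalgebra_def finite_measure_subalgebra_axioms_def)
  then show ?thesis
    by (rule finite_measure_subalgebra_is_sigma_finite)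
qed

text \<open>The conditional law given the history, integrated over the event that \<open>S k\<close>
  lies in \<open>B\<close>. Every later use of the Markov property passes through this
  formula.\<close>

lemma emeasure_kendall_walk_joint:
  assumes walk: "kendall_random_walk \<alpha> \<nu> M S" and "\<alpha> > 0" "\<nu> \<in> P_plus" and kn: "1 \<le> k" "k < n"
    and B: "B \<in> sets borel_nonneg"
  shows "emeasure M {\<omega> \<in> space M. S k \<omega> \<in> B \<and> S n \<omega> \<le> t}
    = (\<integral>\<^sup>+\<omega>. indicator B (S k \<omega>)
        * emeasure (kendall_conv \<alpha> (return borel_nonneg (S k \<omega>)) (kendall_power \<alpha> \<nu> (n - k))) {0..t} \<partial>M)"
proof -
  interpret prob_space M
    using walk by (simp add: kendall_random_walk_def)
  interpret H: sigma_finite_subalgebra M "history M S k"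
    using walk by (rule sigma_finite_subalgebra_history)
  have S [measurable]: "S k \<in> M \<rightarrow>\<^sub>M borel_nonneg" "S n \<in> M \<rightarrow>\<^sub>M borel_nonneg"
    using walk kn by (simp_all add: kendall_random_walk_def)
  have pos: "0 \<le> S k \<omega>" "0 \<le> S n \<omega>" if "\<omega> \<in> space M" for \<omega>
    using measurable_space[OF S(1) that] measurable_space[OF S(2) that] by simp_all
  let ?K = "\<lambda>\<omega>. kendall_conv \<alpha> (return borel_nonneg (S k \<omega>)) (kendall_power \<alpha> \<nu> (n - k))"
  have K: "?K \<omega> \<in> P_plus" if "\<omega> \<in> space M" for \<omega>
    using assms pos[OF that] by (simp add: kendall_conv_in_P_plus return_in_P_plus kendall_power_in_P_plus)
  define A where "A = S n -` {0..t} \<inter> space M"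
  define C where "C = S k -` B \<inter> space M"
  have T: "{0..t} \<in> sets borel_nonneg"
    by (auto simp: sets_restrict_space_iff)
  have A: "A \<in> sets M" and C: "C \<in> sets M"
    unfolding A_def C_def using T B by (auto intro: measurable_sets[OF S(1)] measurable_sets[OF S(2)])
  \<comment> \<open>The history runs over the times \<open>1..k\<close>, so it contains the event at
    time \<open>k\<close> itself because \<open>1 \<le> k\<close>.\<close>
  have "C \<in> (\<Union>i\<in>{1..k}. {S i -` A \<inter> space M | A. A \<in> sets borel_nonneg})"
    unfolding C_def using B kn by (intro UN_I[of k]) auto
  then have CH: "C \<in> sets (history M S k)"
    unfolding history_def by (subst sets_measure_of) (auto simp: sigma_sets.Basic)
  have ce: "AE \<omega> in M. real_cond_exp M (history M S k) (indicator A) \<omega> = measure (?K \<omega>) {0..t}"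
    using walk kn T unfolding kendall_random_walk_def A_def by blast
  have eqset: "{\<omega> \<in> space M. S k \<omega> \<in> B \<and> S n \<omega> \<le> t} = C \<inter> A"
    using pos by (auto simp: A_def C_def)
  have "measure M (C \<inter> A) = (\<integral>\<omega>\<in>C. indicator A \<omega> \<partial>M)"
    using A C by (simp add: set_lebesgue_integral_def flip: indicator_inter_arith)
  also have "\<dots> = (\<integral>\<omega>\<in>C. real_cond_exp M (history M S k) (indicator A) \<omega> \<partial>M)"
    using A CH by (intro H.real_cond_exp_intA) (auto simp: emeasure_eq_measure)
  finally have m: "measure M (C \<inter> A) = (\<integral>\<omega>. indicator C \<omega> * real_cond_exp M (history M S k) (indicator A) \<omega> \<partial>M)"
    by (simp add: set_lebesgue_integral_def)
  have int: "integrable M (\<lambda>\<omega>. indicator C \<omega> * real_cond_exp M (history M S k) (indicator A) \<omega>)"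
    using integrable_mult_indicator[OF C H.real_cond_exp_int(1)[of "indicator A"]] A
    by (simp add: emeasure_eq_measure)
  have "emeasure M (C \<inter> A) = ennreal (\<integral>\<omega>. indicator C \<omega> * real_cond_exp M (history M S k) (indicator A) \<omega> \<partial>M)"
    by (simp add: emeasure_eq_measure m)
  \<comment> \<open>By \<open>ce\<close> the conditional expectation is almost everywhere the mass
    of a set, hence nonnegative, so the two integrals agree.\<close>
  also have "\<dots> = (\<integral>\<^sup>+\<omega>. ennreal (indicator C \<omega> * real_cond_exp M (history M S k) (indicator A) \<omega>) \<partial>M)"
    using ce by (intro nn_integral_eq_integral[symmetric] int) (auto elim!: AE_mp)
  also have "\<dots> = (\<integral>\<^sup>+\<omega>. indicator B (S k \<omega>) * emeasure (?K \<omega>) {0..t} \<partial>M)"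
  proof (rule nn_integral_cong_AE)
    show "AE \<omega> in M. ennreal (indicator C \<omega> * real_cond_exp M (history M S k) (indicator A) \<omega>)
        = indicator B (S k \<omega>) * emeasure (?K \<omega>) {0..t}"
      using ce AE_space
    proof eventually_elim
      case (elim \<omega>)
      have "emeasure (?K \<omega>) {0..t} = ennreal (measure (?K \<omega>) {0..t})"
        using K[OF elim(2)]
        by (intro finite_measure.emeasure_eq_measure prob_space.finite_measure) (simp add: P_plus_iff)
      then show ?case
        using elim by (simp add: C_def indicator_def)
    qed
  qed
  finally show ?thesis
    unfolding eqset .
qed

text \<open>From a position above \<open>t\<close> the transition law gives \<open>{0..t}\<close> no
  mass. Monotonicity is stated for one level \<open>t\<close> at a time, which is all that the
  counting of steps below \<open>t\<close> requires.\<close>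

lemma kendall_walk_mono:
  assumes walk: "kendall_random_walk \<alpha> \<nu> M S" and "\<alpha> > 0" "\<nu> \<in> P_plus" and kn: "1 \<le> k" "k < n"
  shows "AE \<omega> in M. S n \<omega> \<le> t \<longrightarrow> S k \<omega> \<le> t"
proof -
  have S [measurable]: "S k \<in> M \<rightarrow>\<^sub>M borel_nonneg" "S n \<in> M \<rightarrow>\<^sub>M borel_nonneg"
    using walk kn by (simp_all add: kendall_random_walk_def)
  have pos: "0 \<le> S k \<omega>" if "\<omega> \<in> space M" for \<omega>
    using measurable_space[OF S(1) that] by simp
  have B: "{x\<in>{0..}. t < x} \<in> sets borel_nonneg"
    by (auto simp: sets_restrict_space_iff)
  have "emeasure M {\<omega> \<in> space M. S k \<omega> \<in> {x\<in>{0..}. t < x} \<and> S n \<omega> \<le> t} = (\<integral>\<^sup>+\<omega>. 0 \<partial>M)"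
    unfolding emeasure_kendall_walk_joint[OF walk assms(2,3) kn B]
    using assms pos
    by (intro nn_integral_cong)
       (auto simp: indicator_def emeasure_kendall_conv_return kendall_power_in_P_plus
          williamson_def truncated_power_def)
  moreover have "{\<omega> \<in> space M. S k \<omega> \<in> {x\<in>{0..}. t < x} \<and> S n \<omega> \<le> t} \<in> sets M"
  proof -
    have [measurable]: "S k \<in> borel_measurable M" "S n \<in> borel_measurable M"
      using S by (simp_all add: measurable_restrict_space2_iff)
    show ?thesis by measurable
  qed
  ultimately have "{\<omega> \<in> space M. S k \<omega> \<in> {x\<in>{0..}. t < x} \<and> S n \<omega> \<le> t} \<in> null_sets M"
    by auto
  then show ?thesis
    by (rule AE_I') (use pos in \<open>auto simp: not_le\<close>)
qed

text \<open>Conditioning on time 1 alone suffices: \<open>S 1\<close> has law \<open>\<nu>\<close>,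
  and the transition over the remaining \<open>n\<close> steps is already given by the
  \<open>n\<close>-th power, so no induction is required.\<close>

lemma emeasure_kendall_walk_le:
  assumes walk: "kendall_random_walk \<alpha> \<nu> M S" and "\<alpha> > 0" "\<nu> \<in> P_plus" "0 \<le> t"
  shows "emeasure M {\<omega> \<in> space M. S (Suc n) \<omega> \<le> t} = emeasure (kendall_power \<alpha> \<nu> (Suc n)) {0..t}"
proof -
  have S1 [measurable]: "S 1 \<in> M \<rightarrow>\<^sub>M borel_nonneg" and law: "distr M borel_nonneg (S 1) = \<nu>"
    using walk by (auto simp: kendall_random_walk_def)
  have pos: "0 \<le> S 1 \<omega>" if "\<omega> \<in> space M" for \<omega>
    using measurable_space[OF S1 that] by simp
  note [measurable] = S1[unfolded One_nat_def]
  have [measurable]: "williamson \<alpha> t \<in> borel_measurable borel_nonneg" "truncated_power \<alpha> t \<in> borel_measurable borel_nonneg"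
    by (auto intro!: measurable_restrict_space1)
  have P: "kendall_power \<alpha> \<nu> n \<in> P_plus" for n
    using assms by (intro kendall_power_in_P_plus)
  show ?thesis
  proof (cases n)
    case 0
    have "emeasure M {\<omega> \<in> space M. S (Suc n) \<omega> \<le> t} = emeasure M (S 1 -` {0..t} \<inter> space M)"
      using pos 0 by (intro arg_cong[where f="emeasure M"]) auto
    also have "\<dots> = emeasure (distr M borel_nonneg (S 1)) {0..t}"
      by (rule emeasure_distr[symmetric]) (auto simp: sets_restrict_space_iff)
    \<comment> \<open>The first power is \<open>\<nu>\<close> convolved with the point mass at 0;
      its mass is matched with that of \<open>\<nu>\<close> through the two transforms at exponent
      1.\<close>
    also have "\<dots> = emeasure (kendall_power \<alpha> \<nu> (Suc n)) {0..t}"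
      using assms P[of 1] williamson_transform_kendall_power[of \<alpha> \<nu> t 1] truncated_moment_kendall_power[of \<alpha> \<nu> t 1]
      unfolding law 0 by (simp add: emeasure_eq_williamson[OF assms(2)] del: kendall_power.simps)
    finally show ?thesis .
  next
    case (Suc m)
    let ?\<mu> = "kendall_power \<alpha> \<nu> n"
    have B: "{0..} \<in> sets borel_nonneg"
      by (auto simp: sets_restrict_space_iff)
    have "emeasure M {\<omega> \<in> space M. S (Suc n) \<omega> \<le> t} = emeasure M {\<omega> \<in> space M. S 1 \<omega> \<in> {0..} \<and> S (Suc n) \<omega> \<le> t}"
      using pos by (intro arg_cong[where f="emeasure M"]) auto
    also have "\<dots> = (\<integral>\<^sup>+\<omega>. ennreal (williamson \<alpha> t (S 1 \<omega>)) * emeasure ?\<mu> {0..t}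
        + ennreal (truncated_power \<alpha> t (S 1 \<omega>)) * williamson_transform \<alpha> t ?\<mu> \<partial>M)"
      using Suc assms B pos P
      by (subst emeasure_kendall_walk_joint[OF walk assms(2,3)])
         (auto intro!: nn_integral_cong simp: indicator_def emeasure_kendall_conv_return simp del: kendall_power.simps)
    also have "\<dots> = (\<integral>\<^sup>+x. ennreal (williamson \<alpha> t x) * emeasure ?\<mu> {0..t}
        + ennreal (truncated_power \<alpha> t x) * williamson_transform \<alpha> t ?\<mu> \<partial>\<nu>)"
      by (subst law[symmetric], subst nn_integral_distr) auto
    also have "\<dots> = williamson_transform \<alpha> t \<nu> * emeasure ?\<mu> {0..t} + truncated_moment \<alpha> t \<nu> * williamson_transform \<alpha> t ?\<mu>"
      using williamson_measurable_P_plus[OF assms(3)]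
      by (simp add: nn_integral_add nn_integral_multc williamson_transform_def truncated_moment_def)
    also have "\<dots> = emeasure (kendall_power \<alpha> \<nu> (Suc n)) {0..t}"
      using assms P[of n] P[of "Suc n"]
      by (simp add: emeasure_eq_williamson[OF assms(2)] williamson_transform_kendall_conv truncated_moment_kendall_conv algebra_simps)
    finally show ?thesis .
  qed
qed

section \<open>Counting the steps before the level is crossed\<close>

lemma ennreal_of_enat_Inf:
  "ennreal_of_enat (Inf {enat n | n. P n}) = (\<Sum>n. indicator {n. \<forall>k\<le>n. \<not> P k} n)"
\<comment> \<open>If some index satisfies \<open>P\<close>, the indices with no success so far are
  exactly those below the least one. Otherwise every summand is 1 and both sides are
  infinite.\<close>
proof (cases "\<exists>n. P n")
  case True
  define N where "N = (LEAST n. P n)"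
  have N: "P N" "\<And>k. P k \<Longrightarrow> N \<le> k"
    using True by (auto simp: N_def intro: LeastI_ex Least_le)
  have "Inf {enat n | n. P n} = enat N"
    using N by (intro antisym Inf_lower Inf_greatest) auto
  moreover have "{n. \<forall>k\<le>n. \<not> P k} = {..<N}"
    using N by (auto simp: not_le[symmetric]) (metis le_trans)
  moreover have "(\<Sum>n. indicator {..<N} n :: ennreal) = (\<Sum>n<N. indicator {..<N} n)"
    by (rule suminf_finite) auto
  ultimately show ?thesis by simp
next
  case False
  then have "{enat n | n. P n} = {}" "{n. \<forall>k\<le>n. \<not> P k} = UNIV" by auto
  moreover have "(\<Sum>n::nat. 1 :: ennreal) = top"
  proof -
    have "(of_nat n :: ennreal) \<le> (\<Sum>n::nat. 1)" for n
      using sum_le_suminf[of "\<lambda>_::nat. 1::ennreal" "{..<n}"] by simp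
    then show ?thesis
      by (metis ennreal_Ex_less_of_nat linorder_not_less top.not_eq_extremum)
  qed
  ultimately show ?thesis by (simp add: Inf_enat_def)
qed

text \<open>Writing the renewal time as a sum of indicators turns its expectation into a sum of
  probabilities. The index \<open>n\<close> of the renewal process refers to position
  \<open>n + 1\<close>, so the sum starts at the first power.\<close>

lemma renewal_function_eq_suminf:
  assumes walk: "kendall_random_walk \<alpha> \<nu> M S" and "\<alpha> > 0" "\<nu> \<in> P_plus" "0 \<le> t"
  shows "renewal_function M S t = (\<Sum>n. emeasure (kendall_power \<alpha> \<nu> (Suc n)) {0..t})"
proof -
  have [measurable]: "S (Suc n) \<in> borel_measurable M" for n
    using walk by (simp add: kendall_random_walk_def measurable_restrict_space2_iff)
  have "renewal_function M S t = (\<integral>\<^sup>+\<omega>. (\<Sum>n. indicator {\<omega> \<in> space M. \<forall>k\<le>n. S (Suc k) \<omega> \<le> t} \<omega>) \<partial>M)"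
    unfolding renewal_function_def renewal_process_def ennreal_of_enat_Inf
    by (intro nn_integral_cong suminf_cong) (auto simp: indicator_def not_less)
  also have "\<dots> = (\<Sum>n. emeasure M {\<omega> \<in> space M. \<forall>k\<le>n. S (Suc k) \<omega> \<le> t})"
    by (subst nn_integral_suminf) auto
  \<comment> \<open>By monotonicity, staying below \<open>t\<close> at all times up to
    \<open>Suc n\<close> is almost surely the same as being below \<open>t\<close> at the last of
    them.\<close>
  also have "\<dots> = (\<Sum>n. emeasure M {\<omega> \<in> space M. S (Suc n) \<omega> \<le> t})"
  proof (intro suminf_cong emeasure_eq_AE)
    fix n
    have "AE \<omega> in M. \<forall>k. k < n \<longrightarrow> S (Suc n) \<omega> \<le> t \<longrightarrow> S (Suc k) \<omega> \<le> t"
      unfolding AE_all_countable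
      using kendall_walk_mono[OF walk assms(2,3)] by auto
    then show "AE \<omega> in M. \<omega> \<in> {\<omega> \<in> space M. \<forall>k\<le>n. S (Suc k) \<omega> \<le> t} \<longleftrightarrow> \<omega> \<in> {\<omega> \<in> space M. S (Suc n) \<omega> \<le> t}"
      by eventually_elim (auto simp: le_less)
  qed auto
  also have "\<dots> = (\<Sum>n. emeasure (kendall_power \<alpha> \<nu> (Suc n)) {0..t})"
    using assms by (intro suminf_cong emeasure_kendall_walk_le)
  finally show ?thesis .
qed


section \<open>Asymptotics\<close>

lemma moment_eq_integral:
  assumes "\<nu> \<in> P_plus" "moment \<alpha> \<nu> < \<infinity>"
  shows "integrable \<nu> (\<lambda>x. x powr \<alpha>)" "moment \<alpha> \<nu> = ennreal (\<integral>x. x powr \<alpha> \<partial>\<nu>)"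
proof -
  have [measurable]: "(\<lambda>x. x powr \<alpha>) \<in> borel_measurable \<nu>"
    by (rule borel_measurable_P_plus[OF assms(1)]) measurable
  show *: "integrable \<nu> (\<lambda>x. x powr \<alpha>)"
    using assms by (intro integrableI_nonneg) (auto simp: moment_def)
  show "moment \<alpha> \<nu> = ennreal (\<integral>x. x powr \<alpha> \<partial>\<nu>)"
    unfolding moment_def by (rule nn_integral_eq_integral[OF *]) simp
qed

text \<open>A vanishing integral forces \<open>x powr \<alpha> = 0\<close>, hence
  \<open>x = 0\<close>, almost everywhere, and then \<open>\<nu>\<close> is the excluded point
  mass.\<close>

lemma integral_powr_pos:
  assumes "\<nu> \<in> P_plus" "\<nu> \<noteq> return borel_nonneg 0" "moment \<alpha> \<nu> < \<infinity>"
  shows "0 < (\<integral>x. x powr \<alpha> \<partial>\<nu>)"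
proof (rule ccontr)
  interpret prob_space \<nu> using assms by (simp add: P_plus_iff)
  note int = moment_eq_integral(1)[OF assms(1,3)]
  have s: "sets \<nu> = sets borel_nonneg" using assms by (simp add: P_plus_iff)
  assume "\<not> 0 < (\<integral>x. x powr \<alpha> \<partial>\<nu>)"
  moreover have "0 \<le> (\<integral>x. x powr \<alpha> \<partial>\<nu>)"
    by (intro integral_nonneg_AE) auto
  ultimately have "(\<integral>x. x powr \<alpha> \<partial>\<nu>) = 0" by linarith
  then have "AE x in \<nu>. x powr \<alpha> = 0"
    by (subst (asm) integral_nonneg_eq_0_iff_AE[OF int]) auto
  then have ae: "AE x in \<nu>. x = 0" by simp
  have "\<nu> = return borel_nonneg 0"
  proof (rule measure_eqI)
    fix A assume A: "A \<in> sets \<nu>"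
    have "emeasure \<nu> A = (\<integral>\<^sup>+x. indicator A x \<partial>\<nu>)"
      using A by simp
    also have "\<dots> = (\<integral>\<^sup>+x. indicator A 0 \<partial>\<nu>)"
      using ae by (intro nn_integral_cong_AE) auto
    also have "\<dots> = emeasure (return borel_nonneg 0) A"
      unfolding nn_integral_const emeasure_space_1 using A s by simp
    finally show "emeasure \<nu> A = emeasure (return borel_nonneg 0) A" .
  qed (simp add: s)
  with assms(2) show False by contradiction
qed

lemma H_eq: "H \<alpha> \<nu> t = (\<integral>x. indicator {0..t} x * x powr \<alpha> \<partial>\<nu>)"
  by (simp add: H_def set_lebesgue_integral_def)

lemma integrable_truncation:
  assumes "\<nu> \<in> P_plus" "moment \<alpha> \<nu> < \<infinity>"
  shows "integrable \<nu> (\<lambda>x. indicator {0..t} x * x powr \<alpha>)"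
proof -
  have "{0..t} \<in> sets \<nu>"
    using assms by (auto simp: P_plus_iff sets_restrict_space_iff)
  then show ?thesis
    using integrable_mult_indicator[OF _ moment_eq_integral(1)[OF assms]] by simp
qed

lemma H_mono:
  assumes "\<nu> \<in> P_plus" "moment \<alpha> \<nu> < \<infinity>"
  shows "mono (H \<alpha> \<nu>)"
  unfolding H_eq using integrable_truncation[OF assms]
  by (intro monoI integral_mono) (auto simp: indicator_def)

text \<open>Dominated convergence with the moment integrand as majorant; at each fixed point the
  truncation is eventually inactive.\<close>

lemma H_tendsto:
  assumes "\<nu> \<in> P_plus" "moment \<alpha> \<nu> < \<infinity>"
  shows "(H \<alpha> \<nu> \<longlongrightarrow> (\<integral>x. x powr \<alpha> \<partial>\<nu>)) at_top"
  unfolding H_eq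
proof (rule integral_dominated_convergence_at_top)
  show "(\<lambda>x. x powr \<alpha>) \<in> borel_measurable \<nu>" "integrable \<nu> (\<lambda>x. x powr \<alpha>)"
    using moment_eq_integral(1)[OF assms] by auto
  show "(\<lambda>x. indicator {0..t} x * x powr \<alpha>) \<in> borel_measurable \<nu>" for t
    using integrable_truncation[OF assms] by auto
  show "\<forall>\<^sub>F t in at_top. AE x in \<nu>. norm (indicator {0..t} x * x powr \<alpha>) \<le> x powr \<alpha>"
    by (auto simp: indicator_def)
  show "AE x in \<nu>. ((\<lambda>t. indicator {0..t} x * x powr \<alpha>) \<longlongrightarrow> x powr \<alpha>) at_top"
  proof (intro AE_I2 tendsto_eventually)
    fix x assume "x \<in> space \<nu>"
    then have "0 \<le> x" using assms by (simp add: space_P_plus)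
    then show "\<forall>\<^sub>F t in at_top. indicator {0..t} x * x powr \<alpha> = x powr \<alpha>"
      by (intro eventually_mono[OF eventually_ge_at_top[of x]]) simp
  qed
qed

text \<open>On \<open>{t<..}\<close> the constant \<open>t powr \<alpha>\<close> is at most
  \<open>x powr \<alpha>\<close>, as in the Markov inequality. With this majorant dominated
  convergence improves a bound to the limit 0.\<close>

lemma F_bar_tendsto:
  assumes "\<alpha> > 0" "\<nu> \<in> P_plus" "moment \<alpha> \<nu> < \<infinity>"
  shows "((\<lambda>t. t powr \<alpha> * F_bar \<nu> t) \<longlongrightarrow> 0) at_top"
proof -
  have meas: "(\<lambda>x. t powr \<alpha> * indicator {t<..} x) \<in> borel_measurable \<nu>" for t
    by (rule borel_measurable_P_plus[OF assms(2)]) measurable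
  have "((\<lambda>t. \<integral>x. t powr \<alpha> * indicator {t<..} x \<partial>\<nu>) \<longlongrightarrow> (\<integral>x. 0 \<partial>\<nu>)) at_top"
  proof (rule integral_dominated_convergence_at_top)
    show "integrable \<nu> (\<lambda>x. x powr \<alpha>)"
      by (rule moment_eq_integral(1)[OF assms(2,3)])
    show "\<forall>\<^sub>F t in at_top. AE x in \<nu>. norm (t powr \<alpha> * indicator {t<..} x) \<le> x powr \<alpha>"
      using eventually_ge_at_top[of 0]
    proof eventually_elim
      case (elim t)
      then show ?case
        using assms(1) by (intro AE_I2) (simp add: indicator_def powr_mono2)
    qed
    show "AE x in \<nu>. ((\<lambda>t. t powr \<alpha> * indicator {t<..} x) \<longlongrightarrow> 0) at_top"
    proof (intro AE_I2 tendsto_eventually)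
      show "\<forall>\<^sub>F t in at_top. t powr \<alpha> * indicator {t<..} x = 0" for x :: real
        using eventually_ge_at_top[of x] by eventually_elim simp
    qed
  qed (rule measurable_const meas | simp)+
  moreover have "(\<integral>x. t powr \<alpha> * indicator {t<..} x \<partial>\<nu>) = t powr \<alpha> * F_bar \<nu> t" for t
  proof -
    have "{x \<in> space \<nu>. t < x} = {t<..} \<inter> space \<nu>" by auto
    then show ?thesis
      unfolding F_bar_def by (subst integral_mult_right_zero) simp
  qed
  ultimately show ?thesis
    by (simp only: integral_zero)
qed

section \<open>\<open>G\<close> and \<open>H\<close> as transforms of the step law\<close>

lemma truncated_moment_eq_H:
  assumes "\<alpha> > 0" "\<nu> \<in> P_plus" "moment \<alpha> \<nu> < \<infinity>" "t > 0"
  shows "truncated_moment \<alpha> t \<nu> = ennreal (H \<alpha> \<nu> t / t powr \<alpha>)"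
proof -
  have "truncated_moment \<alpha> t \<nu> = (\<integral>\<^sup>+x. ennreal (indicator {0..t} x * x powr \<alpha> / t powr \<alpha>) \<partial>\<nu>)"
    unfolding truncated_moment_def
    using assms by (intro nn_integral_cong) (auto simp: truncated_power_def indicator_def powr_divide)
  also have "\<dots> = ennreal (\<integral>x. indicator {0..t} x * x powr \<alpha> / t powr \<alpha> \<partial>\<nu>)"
    using assms integrable_truncation[OF assms(2,3)] by (intro nn_integral_eq_integral) auto
  finally show ?thesis by (simp add: H_eq)
qed

lemma H_nonneg: "0 \<le> H \<alpha> \<nu> t"
  by (simp add: H_eq integral_nonneg_AE)

lemma williamson_eq_max:
  assumes "\<alpha> > 0" "t > 0" "0 \<le> x"
  shows "williamson \<alpha> t x = max (1 - x powr \<alpha> / t powr \<alpha>) 0"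
proof (cases "x \<le> t")
  case True
  then have "x powr \<alpha> \<le> t powr \<alpha>" using assms by (intro powr_mono2) auto
  then show ?thesis
    using True assms by (simp add: williamson_def powr_divide)
next
  case False
  then have "t powr \<alpha> \<le> x powr \<alpha>" using assms by (intro powr_mono2) auto
  then show ?thesis
    using False assms by (simp add: williamson_def field_simps)
qed

lemma G_eq:
  assumes "\<alpha> > 0" "\<nu> \<in> P_plus" "t > 0"
  shows "G \<alpha> \<nu> t = (\<integral>x. williamson \<alpha> t x \<partial>\<nu>)"
  unfolding G_def using assms by (intro Bochner_Integration.integral_cong) (auto simp: space_P_plus williamson_eq_max)

lemma integrable_williamson:
  assumes "\<alpha> > 0" "\<nu> \<in> P_plus"
  shows "integrable \<nu> (williamson \<alpha> t)"
proof -
  interpret prob_space \<nu> using assms by (simp add: P_plus_iff)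
  have "norm (williamson \<alpha> t x) \<le> 1" for x
  proof -
    have "indicator {0..t} x \<le> (1 :: real)"
      by (simp add: indicator_def)
    then show ?thesis
      using williamson_nonneg[of \<alpha> t x] truncated_power_nonneg[of \<alpha> t x] assms
        williamson_add_truncated_power[of \<alpha> t x]
      unfolding real_norm_def by linarith
  qed
  then show ?thesis
    using williamson_measurable_P_plus[OF assms(2)] by (intro integrable_const_bound[where B=1]) auto
qed

lemma williamson_transform_eq_G:
  assumes "\<alpha> > 0" "\<nu> \<in> P_plus" "t > 0"
  shows "williamson_transform \<alpha> t \<nu> = ennreal (G \<alpha> \<nu> t)"
  unfolding williamson_transform_def G_eq[OF assms]
  using assms by (intro nn_integral_eq_integral integrable_williamson) (auto simp: williamson_nonneg)

lemma G_nonneg: "0 \<le> G \<alpha> \<nu> t"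
  unfolding G_def by (intro integral_nonneg_AE) auto

text \<open>The mass of \<open>{0..t}\<close> splits into the two transforms of
  \<open>\<nu>\<close>; passing to complements gives the tail plus the normalized truncated
  moment.\<close>

lemma G_bar_eq:
  assumes "\<alpha> > 0" "\<nu> \<in> P_plus" "moment \<alpha> \<nu> < \<infinity>" "t > 0"
  shows "G_bar \<alpha> \<nu> t = F_bar \<nu> t + H \<alpha> \<nu> t / t powr \<alpha>"
proof -
  interpret prob_space \<nu> using assms by (simp add: P_plus_iff)
  have T: "{0..t} \<in> events"
    using assms by (auto simp: P_plus_iff sets_restrict_space_iff)
  have "ennreal (prob {0..t}) = ennreal (G \<alpha> \<nu> t + H \<alpha> \<nu> t / t powr \<alpha>)"
    unfolding emeasure_eq_measure[symmetric] emeasure_eq_williamson[OF assms(1,2)]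
      williamson_transform_eq_G[OF assms(1,2,4)] truncated_moment_eq_H[OF assms]
    by (intro ennreal_plus[symmetric] G_nonneg divide_nonneg_nonneg H_nonneg powr_ge_zero)
  then have "prob {0..t} = G \<alpha> \<nu> t + H \<alpha> \<nu> t / t powr \<alpha>"
    by (subst (asm) ennreal_inj) (auto intro!: add_nonneg_nonneg G_nonneg divide_nonneg_nonneg H_nonneg)
  moreover have "{x \<in> space \<nu>. t < x} = space \<nu> - {0..t}"
    using assms by (auto simp: space_P_plus)
  then have "F_bar \<nu> t = 1 - prob {0..t}"
    using prob_compl[OF T] by (simp add: F_bar_def)
  ultimately show ?thesis
    unfolding G_bar_def by linarith
qed

lemma G_bar_tendsto:
  assumes "\<alpha> > 0" "\<nu> \<in> P_plus" "moment \<alpha> \<nu> < \<infinity>"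
  shows "((\<lambda>t. t powr \<alpha> * G_bar \<alpha> \<nu> t) \<longlongrightarrow> (\<integral>x. x powr \<alpha> \<partial>\<nu>)) at_top"
proof -
  have "((\<lambda>t. t powr \<alpha> * F_bar \<nu> t + H \<alpha> \<nu> t) \<longlongrightarrow> 0 + (\<integral>x. x powr \<alpha> \<partial>\<nu>)) at_top"
    using assms by (intro tendsto_add F_bar_tendsto H_tendsto)
  moreover have "\<forall>\<^sub>F t in at_top. t powr \<alpha> * F_bar \<nu> t + H \<alpha> \<nu> t = t powr \<alpha> * G_bar \<alpha> \<nu> t"
    using eventually_gt_at_top[of 0]
    by eventually_elim (use assms in \<open>simp add: G_bar_eq distrib_left\<close>)
  ultimately show ?thesis
    unfolding add_0 by (rule Lim_transform_eventually)
qed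

section \<open>Closed form and limit of the renewal function\<close>

lemma renewal_function_eq:
  assumes walk: "kendall_random_walk \<alpha> \<nu> M S" and "\<alpha> > 0" "\<nu> \<in> P_plus" "moment \<alpha> \<nu> < \<infinity>" "0 < t"
    and Gb: "0 < G_bar \<alpha> \<nu> t"
  shows "renewal_function M S t
    = ennreal (G \<alpha> \<nu> t / G_bar \<alpha> \<nu> t + H \<alpha> \<nu> t / t powr \<alpha> / (G_bar \<alpha> \<nu> t)\<^sup>2)"
proof -
  define g h where "g = G \<alpha> \<nu> t" and "h = H \<alpha> \<nu> t / t powr \<alpha>"
  have g: "0 \<le> g" "g < 1" and h: "0 \<le> h"
    using Gb by (auto simp: g_def h_def G_bar_def G_nonneg H_nonneg)
  have wt: "williamson_transform \<alpha> t \<nu> = ennreal g" "truncated_moment \<alpha> t \<nu> = ennreal h"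
    using assms by (simp_all add: g_def h_def williamson_transform_eq_G truncated_moment_eq_H)
  have "renewal_function M S t = (\<Sum>n. emeasure (kendall_power \<alpha> \<nu> (Suc n)) {0..t})"
    using assms by (intro renewal_function_eq_suminf) auto
  also have "\<dots> = (\<Sum>n. ennreal (g * g ^ n + real (Suc n) * g ^ n * h))"
  proof (rule suminf_cong)
    fix n
    have "emeasure (kendall_power \<alpha> \<nu> (Suc n)) {0..t} = ennreal g ^ Suc n + of_nat (Suc n) * ennreal g ^ n * ennreal h"
      using assms kendall_power_in_P_plus[of \<alpha> \<nu> "Suc n"]
        williamson_transform_kendall_power[of \<alpha> \<nu> t "Suc n"] truncated_moment_kendall_power[of \<alpha> \<nu> t "Suc n"]
      by (simp add: emeasure_eq_williamson wt del: kendall_power.simps of_nat_Suc)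
    also have "\<dots> = ennreal (g * g ^ n + real (Suc n) * g ^ n * h)"
      using g h by (simp add: ennreal_of_nat_eq_real_of_nat ennreal_power ennreal_mult ennreal_plus del: of_nat_Suc)
    finally show "emeasure (kendall_power \<alpha> \<nu> (Suc n)) {0..t} = ennreal (g * g ^ n + real (Suc n) * g ^ n * h)" .
  qed
  \<comment> \<open>A geometric series and its derivative, both convergent because positivity of
    \<open>G_bar\<close> means \<open>g < 1\<close>.\<close>
  also have "\<dots> = ennreal (g * (1 / (1 - g)) + 1 / (1 - g)\<^sup>2 * h)"
    using g h by (intro suminf_ennreal_eq sums_add sums_mult sums_mult2 geometric_sums geometric_deriv_sums) auto
  finally show ?thesis
    by (simp add: g_def h_def G_bar_def mult.commute)
qed

lemma renewal_function_tendsto: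
  assumes walk: "kendall_random_walk \<alpha> \<nu> M S" and "\<alpha> > 0" "\<nu> \<in> P_plus" "moment \<alpha> \<nu> < \<infinity>"
    and "\<nu> \<noteq> return borel_nonneg 0"
  defines "m \<equiv> \<integral>x. x powr \<alpha> \<partial>\<nu>"
  shows "((\<lambda>t. ennreal (t powr (- \<alpha>)) * renewal_function M S t) \<longlongrightarrow> ennreal (2 / m)) at_top"
proof -
  \<comment> \<open>Dividing the closed form by \<open>t powr \<alpha>\<close> leaves
    \<open>t\<close> only through \<open>t powr (- \<alpha>)\<close>, \<open>H\<close> and
    \<open>D\<close>, all of which converge. The two summands then contribute \<open>1 / m\<close>
    each.\<close>
  define D where "D t = t powr \<alpha> * G_bar \<alpha> \<nu> t" for t
  have m: "m > 0"
    unfolding m_def by (rule integral_powr_pos[OF assms(3,5,4)])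
  have D: "(D \<longlongrightarrow> m) at_top"
    unfolding D_def m_def by (rule G_bar_tendsto[OF assms(2-4)])
  have "((\<lambda>t. t powr (- \<alpha>)) \<longlongrightarrow> 0) at_top"
    using assms(2) by (intro tendsto_neg_powr filterlim_ident) auto
  then have "((\<lambda>t. (1 - t powr (- \<alpha>) * D t) / D t + H \<alpha> \<nu> t / (D t)\<^sup>2) \<longlongrightarrow> (1 - 0 * m) / m + m / m\<^sup>2) at_top"
    using D m H_tendsto[OF assms(3,4), folded m_def]
    by (intro tendsto_add tendsto_divide tendsto_diff tendsto_mult tendsto_power tendsto_const) auto
  moreover have "(1 - 0 * m) / m + m / m\<^sup>2 = 2 / m"
    using m by (simp add: field_simps power2_eq_square)
  ultimately have "((\<lambda>t. ennreal ((1 - t powr (- \<alpha>) * D t) / D t + H \<alpha> \<nu> t / (D t)\<^sup>2)) \<longlongrightarrow> ennreal (2 / m)) at_top"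
    by (intro tendsto_ennrealI) simp
  moreover have "\<forall>\<^sub>F t in at_top. ennreal ((1 - t powr (- \<alpha>) * D t) / D t + H \<alpha> \<nu> t / (D t)\<^sup>2)
      = ennreal (t powr (- \<alpha>)) * renewal_function M S t"
    \<comment> \<open>The positive limit of \<open>D\<close> makes \<open>G_bar\<close> eventually
      positive, as the closed form requires.\<close>
    using eventually_gt_at_top[of 0] order_tendstoD(1)[OF D m]
  proof eventually_elim
    case (elim t)
    define p where "p = t powr \<alpha>"
    have p: "p > 0" "t powr (- \<alpha>) = 1 / p"
      using elim by (simp_all add: p_def powr_minus divide_inverse)
    have b: "0 < G_bar \<alpha> \<nu> t"
      using elim p by (simp add: D_def p_def zero_less_mult_iff)
    have "(1 - t powr (- \<alpha>) * D t) / D t + H \<alpha> \<nu> t / (D t)\<^sup>2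
      = t powr (- \<alpha>) * (G \<alpha> \<nu> t / G_bar \<alpha> \<nu> t + H \<alpha> \<nu> t / t powr \<alpha> / (G_bar \<alpha> \<nu> t)\<^sup>2)"
    proof -
      have G: "G \<alpha> \<nu> t = 1 - G_bar \<alpha> \<nu> t" by (simp add: G_bar_def)
      show ?thesis
        unfolding D_def p(2) p_def[symmetric] G using p(1) b by (simp add: power2_eq_square divide_simps)
    qed
    then show ?case
      using renewal_function_eq[OF assms(1-4) elim(1) b] by (simp add: ennreal_mult')
  qed
  ultimately show ?thesis
    by (rule Lim_transform_eventually)
qed

theorem corollary2:
  fixes \<alpha> :: real and \<nu> :: "real measure"
    and M :: "'a measure" and S :: "nat \<Rightarrow> 'a \<Rightarrow> real"
  assumes "\<alpha> > 0"
    and "\<nu> \<in> P_plus"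
    and "\<nu> \<noteq> return borel_nonneg 0"
    and "kendall_random_walk \<alpha> \<nu> M S"
    and "moment \<alpha> \<nu> < \<infinity>"
  shows "H \<alpha> \<nu> \<in> RV\<^sub>0
    \<and> ((\<lambda>x. x powr \<alpha> * F_bar \<nu> x) \<longlongrightarrow> 0) at_top
    \<and> ((\<lambda>x. x powr \<alpha> * G_bar \<alpha> \<nu> x) \<longlongrightarrow> enn2real (moment \<alpha> \<nu>)) at_top
    \<and> ((\<lambda>x. ennreal (x powr (- \<alpha>)) * renewal_function M S x) \<longlongrightarrow> 2 / moment \<alpha> \<nu>) at_top"
proof (intro conjI)
  define m where "m = (\<integral>x. x powr \<alpha> \<partial>\<nu>)"
  have m: "m > 0"
    unfolding m_def using assms by (intro integral_powr_pos)
  have moment: "moment \<alpha> \<nu> = ennreal m"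
    unfolding m_def using assms by (intro moment_eq_integral)
  have H: "(H \<alpha> \<nu> \<longlongrightarrow> m) at_top"
    unfolding m_def using assms by (intro H_tendsto)
  show "H \<alpha> \<nu> \<in> RV\<^sub>0"
    unfolding RV\<^sub>0_def
  proof (intro CollectI conjI allI impI)
    \<comment> \<open>A monotone real function is Borel. The rest of slow variation follows from
      convergence to the positive limit \<open>m\<close>: numerator and denominator tend to the same
      nonzero number.\<close>
    show "H \<alpha> \<nu> \<in> borel_measurable borel"
      using assms by (intro borel_measurable_mono H_mono)
    show "\<forall>\<^sub>F t in at_top. 0 < H \<alpha> \<nu> t"
      using order_tendstoD(1)[OF H m] .
    fix x :: real assume "x > 0"
    then have "filterlim (\<lambda>t. t * x) at_top at_top"
      using filterlim_at_top_mult_tendsto_pos[OF tendsto_const _ filterlim_ident] by blast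
    then have "((\<lambda>t. H \<alpha> \<nu> (t * x)) \<longlongrightarrow> m) at_top"
      by (rule filterlim_compose[OF H])
    then have "((\<lambda>t. H \<alpha> \<nu> (t * x) / H \<alpha> \<nu> t) \<longlongrightarrow> m / m) at_top"
      using m by (intro tendsto_divide H) auto
    then show "((\<lambda>t. H \<alpha> \<nu> (t * x) / H \<alpha> \<nu> t) \<longlongrightarrow> 1) at_top"
      using m by simp
  qed
  show "((\<lambda>x. x powr \<alpha> * F_bar \<nu> x) \<longlongrightarrow> 0) at_top"
    using assms by (intro F_bar_tendsto)
  show "((\<lambda>x. x powr \<alpha> * G_bar \<alpha> \<nu> x) \<longlongrightarrow> enn2real (moment \<alpha> \<nu>)) at_top"
    using G_bar_tendsto[OF assms(1,2,5)] m by (simp add: moment m_def)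
  \<comment> \<open>Since \<open>m > 0\<close>, division in \<open>ennreal\<close> agrees with
    division of reals.\<close>
  have "2 / moment \<alpha> \<nu> = ennreal (2 / m)"
    using m by (simp add: moment flip: divide_ennreal)
  then show "((\<lambda>x. ennreal (x powr (- \<alpha>)) * renewal_function M S x) \<longlongrightarrow> 2 / moment \<alpha> \<nu>) at_top"
    using renewal_function_tendsto[OF assms(4,1,2,5,3)] by (simp add: m_def)
qed

end
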